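(* Let $\eta>1/3$ and let $v:[0,T_*]\to L^2_0(\mathbb{T})$ be a solution of the KdV $\Lambda$-equation in $L^2_0$, i.e. $v$ is $\eta$-Hölder in $L^2$, the increment $\delta v_{ts}-X_{ts}(v_s,v_s)$ satisfies $|\delta v_{ts}-X_{ts}(v_s,v_s)|_{L^2}\lesssim|t-s|^{2\eta}$, and $v^\flat_{ts}:=\delta v_{ts}-X_{ts}(v_s,v_s)-X^2_{ts}(v_s,v_s,v_s)$ satisfies $|v^\flat_{ts}|_{L^2}\lesssim|t-s|^{3\eta}$, with initial condition $v_0\in L^2_0(\mathbb{T})$. Then $|v_t|_{L^2(\mathbb{T})}^2=|v_0|_{L^2(\mathbb{T})}^2$ for all $t\in[0,T_*]$.
   Context: $L^2_0(\mathbb{T})$ denotes real $L^2$ functions on $\mathbb{T}=[-\pi,\pi]$ with zero mean ($\hat f(0)=0$, where $f(\xi)=\sum_k\hat f(k)e^{ik\xi}$). $\delta v_{ts}=v_t-v_s$. $\dot X_\sigma$: $\widehat{\dot X_\sigma(\varphi_1,\varphi_2)}(k)=\frac{ik}{2}\sum_{k_1\ne0,k}e^{-3ikk_1k_2\sigma}\hat\varphi_1(k_1)\hat\varphi_2(k_2)$, $k_2=k-k_1$; $X_{ts}=\int_s^t\dot X_\sigma d\sigma$, i.e. $\widehat{X_{ts}(\varphi_1,\varphi_2)}(k)=\sum_{k_1\ne0,k}\frac{e^{-3ikk_1k_2s}-e^{-3ikk_1k_2t}}{6k_1k_2}\hat\varphi_1(k_1)\hat\varphi_2(k_2)$; $X^2_{ts}(\varphi_1,\varphi_2,\varphi_3)=2\int_s^td\sigma\int_s^\sigma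 d\sigma_1\dot X_\sigma(\varphi_1,\dot X_{\sigma_1}(\varphi_2,\varphi_3))$ (bounded bi-/trilinear operators on $L^2_0$). Equivalently $v$ satisfies $\delta v=(\mathrm{id}-\Lambda\delta)[X(v,v)+X^2(v,v,v)]$ with $\Lambda$ the sewing map. *)

theory Defs
  imports "HOL-Analysis.Analysis"
begin

text \<open>Elements of L^2_0(T) are represented by their Fourier coefficients
  f(xi) = sum_k fhat(k) e^{i k xi}; realness is fhat(-k) = conj(fhat(k)),
  zero mean is fhat(0) = 0.\<close>

type_synonym fcoef = "int \<Rightarrow> complex"

definition L2_0 :: "fcoef set" where
  "L2_0 = {f. f 0 = 0 \<and> (\<forall>k. f (-k) = cnj (f k)) \<and>
              (\<lambda>k. (cmod (f k))\<^sup>2) summable_on UNIV}"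

text \<open>L^2(T) norm on T = [-pi,pi], via Parseval.\<close>
definition L2norm :: "fcoef \<Rightarrow> real" where
  "L2norm f = sqrt (2 * pi * (\<Sum>\<^sub>\<infinity>k. (cmod (f k))\<^sup>2))"

definition Xop :: "real \<Rightarrow> real \<Rightarrow> fcoef \<Rightarrow> fcoef \<Rightarrow> fcoef" where
  "Xop t s \<phi>1 \<phi>2 = (\<lambda>k. \<Sum>\<^sub>\<infinity>k1\<in>UNIV - {0, k}.
      (exp (- 3 * \<i> * of_int (k * k1 * (k - k1)) * of_real s)
        - exp (- 3 * \<i> * of_int (k * k1 * (k - k1)) * of_real t))
      / of_int (6 * k1 * (k - k1)) * \<phi>1 k1 * \<phi>2 (k - k1))"

definition Xdot_mult :: "real \<Rightarrow> int \<Rightarrow> int \<Rightarrow> complex" where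
  "Xdot_mult \<sigma> k k1 = (\<i> * of_int k / 2) * exp (- 3 * \<i> * of_int (k * k1 * (k - k1)) * of_real \<sigma>)"

text \<open>Kernel of X^2_{ts}: the time integrals
  2 int_s^t d sigma int_s^sigma d sigma1 of the product of the two Xdot multipliers
  (outer frequencies k = k1 + k2, inner k2 = k3 + k4).\<close>
definition X2_kernel :: "real \<Rightarrow> real \<Rightarrow> int \<Rightarrow> int \<Rightarrow> int \<Rightarrow> complex" where
  "X2_kernel t s k k1 k3 = 2 * integral {s..t} (\<lambda>\<sigma>. integral {s..\<sigma>} (\<lambda>\<sigma>1.
       Xdot_mult \<sigma> k k1 * Xdot_mult \<sigma>1 (k - k1) k3))"

definition X2op :: "real \<Rightarrow> real \<Rightarrow> fcoef \<Rightarrow> fcoef \<Rightarrow> fcoef \<Rightarrow> fcoef" where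
  "X2op t s \<phi>1 \<phi>2 \<phi>3 = (\<lambda>k. \<Sum>\<^sub>\<infinity>(k1, k3)\<in>{(k1, k3). k1 \<noteq> 0 \<and> k1 \<noteq> k \<and> k3 \<noteq> 0 \<and> k3 \<noteq> k - k1}.
      X2_kernel t s k k1 k3 * \<phi>1 k1 * \<phi>2 k3 * \<phi>3 (k - k1 - k3))"

definition KdV_Lambda_solution :: "real \<Rightarrow> real \<Rightarrow> (real \<Rightarrow> fcoef) \<Rightarrow> bool" where
  "KdV_Lambda_solution \<eta> T v \<longleftrightarrow>
     (\<forall>t\<in>{0..T}. v t \<in> L2_0) \<and>
     (\<exists>C. \<forall>s t. 0 \<le> s \<longrightarrow> s \<le> t \<longrightarrow> t \<le> T \<longrightarrow>
        L2norm (v t - v s) \<le> C * \<bar>t - s\<bar> powr \<eta>) \<and>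
     (\<exists>C. \<forall>s t. 0 \<le> s \<longrightarrow> s \<le> t \<longrightarrow> t \<le> T \<longrightarrow>
        L2norm (v t - v s - Xop t s (v s) (v s)) \<le> C * \<bar>t - s\<bar> powr (2 * \<eta>)) \<and>
     (\<exists>C. \<forall>s t. 0 \<le> s \<longrightarrow> s \<le> t \<longrightarrow> t \<le> T \<longrightarrow>
        L2norm (v t - v s - Xop t s (v s) (v s) - X2op t s (v s) (v s) (v s))
          \<le> C * \<bar>t - s\<bar> powr (3 * \<eta>))"

end

theory Submission
  imports Defs
begin

text \<open>
  Write $u = v_s$, $d = \delta v_{ts}$, $r = d - X(u,u)$ and $q = v^\flat_{ts} = r - X^2(u,u,u)$.
  Two algebraic identities hold: $\langle u, X(u,u)\rangle = 0$ and
  $2 \langle u, X^2(u,u,u)\rangle = - |X(u,u)|^2$.  Inserting them into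
  $|u + d|^2 = |u|^2 + 2 \langle u, d\rangle + |d|^2$ gives
  $|v_t|^2 - |v_s|^2 = 2 \langle u, q\rangle + 2 \langle d, r\rangle - |r|^2 = O(|t-s|^{3\eta})$,
  and since $3\eta > 1$ the function $t \mapsto |v_t|^2$ has zero derivative.

  Both identities come from symmetrising absolutely convergent sums over frequencies adding up to
  zero.  For $X$ this is the cyclic identity $1/(bc) + 1/(ca) + 1/(ab) = (a+b+c)/(abc)$.  For $X^2$
  one uses the antisymmetry of the trilinear form $\langle \varphi, \dot X_\sigma(\psi,\chi)\rangle$
  and then swaps the two time variables.
\<close>

subsection \<open>The space of square-summable families\<close>

definition l2 :: "('a \<Rightarrow> complex) \<Rightarrow> bool" where
  "l2 f \<longleftrightarrow> (\<lambda>k. (cmod (f k))\<^sup>2) summable_on UNIV"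

text \<open>The Parseval factor \<open>2 * pi\<close> of \<open>L2norm\<close> is left out, here and
  in \<open>ip\<close>; \<open>L2norm_power2\<close> restores it.\<close>

definition sqnorm :: "('a \<Rightarrow> complex) \<Rightarrow> real" where
  "sqnorm f = (\<Sum>\<^sub>\<infinity>k. (cmod (f k))\<^sup>2)"

definition ip :: "('a \<Rightarrow> complex) \<Rightarrow> ('a \<Rightarrow> complex) \<Rightarrow> complex" where
  "ip f g = (\<Sum>\<^sub>\<infinity>k. cnj (f k) * g k)"

lemma sqnorm_nonneg: "0 \<le> sqnorm f"
  unfolding sqnorm_def by (rule infsum_nonneg) simp

lemma l2_mult_abs_summable:
  assumes "l2 f" "l2 g"
  shows "(\<lambda>k. cmod (f k) * cmod (g k)) summable_on UNIV"
proof -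
  have "(\<lambda>k. (cmod (f k))\<^sup>2 + (cmod (g k))\<^sup>2) summable_on UNIV"
    using assms unfolding l2_def by (rule summable_on_add)
  moreover have "cmod (f k) * cmod (g k) \<le> (cmod (f k))\<^sup>2 + (cmod (g k))\<^sup>2" for k
    using sum_squares_bound[of "cmod (f k)" "cmod (g k)"]
      mult_nonneg_nonneg[OF norm_ge_zero[of "f k"] norm_ge_zero[of "g k"]] by linarith
  ultimately show ?thesis
    by (rule summable_on_comparison_test) auto
qed

lemma ip_summable:
  assumes "l2 f" "l2 g"
  shows "(\<lambda>k. cnj (f k) * g k) summable_on UNIV"
  by (rule abs_summable_summable) (simp add: norm_mult l2_mult_abs_summable[OF assms])

lemma ip_add_right:
  assumes "l2 f" "l2 g" "l2 h"
  shows "ip f (\<lambda>k. g k + h k) = ip f g + ip f h"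
  unfolding ip_def distrib_left
  by (rule infsum_add) (intro ip_summable assms)+

lemma l2_scale:
  assumes "l2 f" shows "l2 (\<lambda>k. c * f k)"
  using assms unfolding l2_def norm_mult power_mult_distrib by (rule summable_on_cmult_right)

lemma l2_add:
  assumes "l2 f" "l2 g" shows "l2 (\<lambda>k. f k + g k)"
proof -
  have "(\<lambda>k. 2 * (cmod (f k))\<^sup>2 + 2 * (cmod (g k))\<^sup>2) summable_on UNIV"
    using assms unfolding l2_def by (intro summable_on_add summable_on_cmult_right)
  moreover have "(cmod (f k + g k))\<^sup>2 \<le> 2 * (cmod (f k))\<^sup>2 + 2 * (cmod (g k))\<^sup>2" for k
    using power_mono[OF norm_triangle_ineq[of "f k" "g k"], of 2]
      sum_squares_bound[of "cmod (f k)" "cmod (g k)"] by (simp add: power2_sum)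
  ultimately show ?thesis
    unfolding l2_def by (rule summable_on_comparison_test) auto
qed

lemma l2_diff:
  assumes "l2 f" "l2 g" shows "l2 (\<lambda>k. f k - g k)"
  using l2_add[OF assms(1) l2_scale[OF assms(2), of "-1"]] by simp

text \<open>Every term is at most the total \<open>?S\<close>, so its square is at most
  \<open>?S\<close> times the term.\<close>

lemma l2_if_abs_summable:
  assumes "(\<lambda>k. cmod (f k)) summable_on UNIV" shows "l2 f"
proof -
  let ?S = "\<Sum>\<^sub>\<infinity>k. cmod (f k)"
  have "cmod (f k) \<le> ?S" for k
    using finite_sum_le_infsum[OF assms, of "{k}"] by simp
  then have "(cmod (f k))\<^sup>2 \<le> ?S * cmod (f k)" for k
    by (simp add: power2_eq_square mult_right_mono)
  moreover have "(\<lambda>k. ?S * cmod (f k)) summable_on UNIV"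
    using assms by (rule summable_on_cmult_right)
  ultimately show ?thesis
    unfolding l2_def by (metis (no_types, lifting) summable_on_comparison_test zero_le_power2)
qed

lemma l2_comparison:
  assumes "l2 g" "\<And>k. cmod (f k) \<le> cmod (g k)" shows "l2 f"
  unfolding l2_def
  by (rule summable_on_comparison_test[OF assms(1)[unfolded l2_def]])
    (simp_all add: power_mono assms(2))

lemma cmod_le_sqnorm:
  assumes "l2 f" shows "cmod (f k) \<le> 1 + sqnorm f"
proof -
  have "(cmod (f k))\<^sup>2 \<le> sqnorm f"
    using finite_sum_le_infsum[OF assms[unfolded l2_def], of "{k}"] by (simp add: sqnorm_def)
  moreover have "cmod (f k) \<le> 1 + (cmod (f k))\<^sup>2"
    using sum_squares_bound[of "cmod (f k)" 1] norm_ge_zero[of "f k"] unfolding mult_1_right power_one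
    by linarith
  ultimately show ?thesis by linarith
qed

lemma sqnorm_add:
  assumes "l2 f" "l2 g"
  shows "sqnorm (\<lambda>k. f k + g k) = sqnorm f + 2 * Re (ip f g) + sqnorm g"
proof -
  have *: "(cmod (f k + g k))\<^sup>2 = ((cmod (f k))\<^sup>2 + 2 * Re (cnj (f k) * g k)) + (cmod (g k))\<^sup>2" for k
    unfolding cmod_power2 by (simp add: power2_eq_square algebra_simps)
  have R: "(\<lambda>k. Re (cnj (f k) * g k)) summable_on UNIV"
    by (rule summable_on_Re[OF ip_summable[OF assms]])
  note S = assms[unfolded l2_def] summable_on_cmult_right[OF R, of 2]
  show ?thesis
    unfolding sqnorm_def ip_def * infsum_Re[OF ip_summable[OF assms], symmetric]
      infsum_add[OF summable_on_add[OF S(1,3)] S(2)] infsum_add[OF S(1,3)] infsum_cmult_right' ..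
qed

lemma sqnorm_diff:
  assumes "l2 f" "l2 g"
  shows "sqnorm (\<lambda>k. f k - g k) = sqnorm f - 2 * Re (ip f g) + sqnorm g"
  using sqnorm_add[OF assms(1) l2_scale[OF assms(2), of "-1"]]
  by (simp add: ip_def sqnorm_def infsum_uminus)

lemma sqnorm_add_le:
  assumes "l2 f" "l2 g"
  shows "sqnorm (\<lambda>k. f k + g k) \<le> 2 * sqnorm f + 2 * sqnorm g"
  using sqnorm_add[OF assms] sqnorm_diff[OF assms] sqnorm_nonneg[of "\<lambda>k. f k - g k"]
  by linarith

lemma ip_Cauchy_Schwarz:
  assumes "l2 f" "l2 g"
  shows "cmod (ip f g) \<le> sqrt (sqnorm f) * sqrt (sqnorm g)"
proof -
  have "cmod (ip f g) \<le> (\<Sum>\<^sub>\<infinity>k. cmod (cnj (f k) * g k))"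
    unfolding ip_def by (rule norm_infsum_bound) (simp add: norm_mult l2_mult_abs_summable[OF assms])
  also have "\<dots> \<le> sqrt (sqnorm f) * sqrt (sqnorm g)"
  proof (rule infsum_le_finite_sums)
    show "(\<lambda>k. cmod (cnj (f k) * g k)) summable_on UNIV"
      by (simp add: norm_mult l2_mult_abs_summable[OF assms])
    fix F :: "'a set" assume F: "finite F"
    have L: "L2_set (\<lambda>k. cmod (h k)) F \<le> sqrt (sqnorm h)" if "l2 h" for h :: "'a \<Rightarrow> complex"
      unfolding L2_set_def sqnorm_def using that F unfolding l2_def
      by (intro real_sqrt_le_mono finite_sum_le_infsum) auto
    have "(\<Sum>k\<in>F. cmod (cnj (f k) * g k)) \<le> L2_set (\<lambda>k. cmod (f k)) F * L2_set (\<lambda>k. cmod (g k)) F"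
      using L2_set_mult_ineq[of "\<lambda>k. cmod (f k)" "\<lambda>k. cmod (g k)" F] by (simp add: norm_mult)
    also have "\<dots> \<le> sqrt (sqnorm f) * sqrt (sqnorm g)"
      using L[OF assms(1)] L[OF assms(2)] by (intro mult_mono) (auto simp: L2_set_nonneg sqnorm_nonneg)
    finally show "(\<Sum>k\<in>F. cmod (cnj (f k) * g k)) \<le> sqrt (sqnorm f) * sqrt (sqnorm g)" .
  qed
  finally show ?thesis .
qed

section \<open>Relation to \<open>L2norm\<close> and \<open>L2_0\<close>\<close>

lemma L2norm_eq: "L2norm f = sqrt (2 * pi) * sqrt (sqnorm f)"
  unfolding L2norm_def sqnorm_def by (simp add: real_sqrt_mult)

lemma L2norm_power2: "(L2norm f)\<^sup>2 = 2 * pi * sqnorm f"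
  unfolding L2norm_eq by (simp add: power_mult_distrib sqnorm_nonneg)

lemma sqrt_sqnorm_le_L2norm: "sqrt (sqnorm f) \<le> L2norm f"
proof -
  have "1 \<le> sqrt (2 * pi)" using pi_gt3 by simp
  then show ?thesis unfolding L2norm_eq
    using mult_right_mono[of 1 "sqrt (2 * pi)" "sqrt (sqnorm f)"] by (simp add: sqnorm_nonneg)
qed

lemma L2_0_l2: "\<phi> \<in> L2_0 \<Longrightarrow> l2 \<phi>"
  by (simp add: L2_0_def l2_def)

lemma L2_0_zero: "\<phi> \<in> L2_0 \<Longrightarrow> \<phi> 0 = 0"
  by (simp add: L2_0_def)

lemma L2_0_uminus: "\<phi> \<in> L2_0 \<Longrightarrow> \<phi> (- k) = cnj (\<phi> k)"
  by (simp add: L2_0_def)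

section \<open>Summability over products and the weight 1/|k|\<close>

text \<open>Sum over \<open>y\<close> first, uniformly in \<open>x\<close>, then over
  \<open>x\<close>. Since \<open>g\<close> may depend on \<open>x\<close>, iterating this handles
  convolution-type sums in several frequencies.\<close>

lemma summable_on_times_bounded:
  fixes f :: "'a \<Rightarrow> real" and g :: "'a \<Rightarrow> 'b \<Rightarrow> real"
  assumes f: "f summable_on UNIV" "\<And>x. 0 \<le> f x"
    and g: "\<And>x. g x summable_on UNIV" "\<And>x y. 0 \<le> g x y" "\<And>x. infsum (g x) UNIV \<le> C"
  shows "(\<lambda>(x, y). f x * g x y) summable_on UNIV"
proof -
  have "(\<lambda>(x, y). f x * g x y) summable_on (SIGMA x:UNIV. UNIV)"
  proof (rule summable_on_SigmaI)
    show "((\<lambda>y. case (x, y) of (x, y) \<Rightarrow> f x * g x y) has_sum f x * infsum (g x) UNIV) UNIV" for x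
      using has_sum_cmult_right[OF has_sum_infsum[OF g(1)[of x]], of "f x"] by simp
    show "(\<lambda>x. f x * infsum (g x) UNIV) summable_on UNIV"
    proof (rule summable_on_comparison_test)
      show "(\<lambda>x. f x * C) summable_on UNIV" using f(1) by (rule summable_on_cmult_left)
      show "f x * infsum (g x) UNIV \<le> f x * C" for x by (intro mult_left_mono f g)
      show "0 \<le> f x * infsum (g x) UNIV" for x by (intro mult_nonneg_nonneg infsum_nonneg f g)
    qed
  qed (use f g in auto)
  then show ?thesis by simp
qed

lemma inverse_square_summable_int:
  "(\<lambda>k::int. (1 / of_int k :: real)\<^sup>2) summable_on UNIV"
proof -
  let ?f = "\<lambda>k::int. (1 / of_int k :: real)\<^sup>2"
  have N: "(\<lambda>n::nat. (1 / of_nat n :: real)\<^sup>2) summable_on UNIV"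
    using inverse_power_summable[of 2, where 'a = real]
    by (subst summable_on_UNIV_nonneg_real_iff) (auto simp: power_one_over inverse_eq_divide power_divide)
  have P: "?f summable_on range int"
    by (subst summable_on_reindex) (use N in \<open>auto simp: o_def\<close>)
  have M: "?f summable_on range (\<lambda>n. - int n)"
    by (subst summable_on_reindex) (use N in \<open>auto simp: o_def inj_on_def\<close>)
  have "k \<in> range int \<union> range (\<lambda>n. - int n)" for k
    by (cases k rule: int_cases2) blast+
  then have "range int \<union> range (\<lambda>n. - int n) = UNIV" by blast
  then show ?thesis using summable_on_union[OF P M] by simp
qed

text \<open>Since $1/0 = 0$ here, the weight of the zero frequency vanishes.\<close>

definition wt :: "int \<Rightarrow> real" where "wt k = 1 / \<bar>of_int k\<bar>"

lemma wt_nonneg: "0 \<le> wt k" by (simp add: wt_def)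

lemma l2_wt: "l2 (\<lambda>k. of_real (wt k))"
  using inverse_square_summable_int by (simp add: l2_def wt_def power_divide norm_divide)

text \<open>Each product is at most the sum of the two squares; translation invariance of the sum of
  squares makes the bound uniform in \<open>n\<close>.\<close>

lemma wt_shift_bound:
  assumes "l2 \<phi>"
  shows "(\<lambda>k. wt k * cmod (\<phi> (k + n))) summable_on UNIV"
    and "\<exists>C. \<forall>n. (\<Sum>\<^sub>\<infinity>k. wt k * cmod (\<phi> (k + n))) \<le> C"
proof -
  have b: "bij (\<lambda>k. k + n)" for n :: int
    by (rule bij_betw_byWitness[of _ "\<lambda>k. k - n"]) auto
  have l: "l2 (\<lambda>k. \<phi> (k + n))" for n
    using assms summable_on_reindex_bij_betw[OF b, of "\<lambda>k. (cmod (\<phi> k))\<^sup>2"] by (simp add: l2_def)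
  have s: "(\<lambda>k. wt k * cmod (\<phi> (k + n))) summable_on UNIV" for n
    using l2_mult_abs_summable[OF l2_wt l[of n]] by (simp add: wt_nonneg)
  show "(\<lambda>k. wt k * cmod (\<phi> (k + n))) summable_on UNIV" by (rule s)
  have "(\<Sum>\<^sub>\<infinity>k. wt k * cmod (\<phi> (k + n))) \<le> (\<Sum>\<^sub>\<infinity>k. (wt k)\<^sup>2) + sqnorm \<phi>" for n
  proof -
    have w2: "(\<lambda>k. (wt k)\<^sup>2) summable_on UNIV" using l2_wt by (simp add: l2_def)
    have p2: "(\<lambda>k. (cmod (\<phi> (k + n)))\<^sup>2) summable_on UNIV" using l[of n] by (simp add: l2_def)
    have "wt k * cmod (\<phi> (k + n)) \<le> (wt k)\<^sup>2 + (cmod (\<phi> (k + n)))\<^sup>2" for k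
      using sum_squares_bound[of "wt k" "cmod (\<phi> (k + n))"]
        mult_nonneg_nonneg[OF wt_nonneg[of k] norm_ge_zero[of "\<phi> (k + n)"]] by linarith
    then have "(\<Sum>\<^sub>\<infinity>k. wt k * cmod (\<phi> (k + n))) \<le> (\<Sum>\<^sub>\<infinity>k. (wt k)\<^sup>2 + (cmod (\<phi> (k + n)))\<^sup>2)"
      by (intro infsum_mono s summable_on_add w2 p2)
    also have "\<dots> = (\<Sum>\<^sub>\<infinity>k. (wt k)\<^sup>2) + sqnorm \<phi>"
      using infsum_add[OF w2 p2] infsum_reindex_bij_betw[OF b, of "\<lambda>k. (cmod (\<phi> k))\<^sup>2" n]
      by (simp add: sqnorm_def)
    finally show ?thesis .
  qed
  then show "\<exists>C. \<forall>n. (\<Sum>\<^sub>\<infinity>k. wt k * cmod (\<phi> (k + n))) \<le> C" by blast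
qed

subsection \<open>Oscillatory integrals and the kernels\<close>

text \<open>The Fourier multiplier of X as a time integral. Unlike the closed formula in
  \<open>Xop\<close>, it needs no excluded frequencies and is differentiable in \<open>t\<close> by
  construction.\<close>

definition Xint :: "real \<Rightarrow> real \<Rightarrow> int \<Rightarrow> int \<Rightarrow> complex" where
  "Xint t s k k1 = integral {s..t} (\<lambda>\<sigma>. Xdot_mult \<sigma> k k1)"

definition osc :: "int \<Rightarrow> real \<Rightarrow> complex" where
  "osc n \<sigma> = exp (- 3 * \<i> * of_int n * of_real \<sigma>)"

lemma norm_osc [simp]: "cmod (osc n \<sigma>) = 1"
  by (simp add: osc_def)

lemma osc_0 [simp]: "osc 0 \<sigma> = 1"
  by (simp add: osc_def)

lemma osc_add: "osc (m + n) \<sigma> = osc m \<sigma> * osc n \<sigma>"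
  by (simp add: osc_def exp_add [symmetric] algebra_simps)

lemma continuous_on_osc [continuous_intros]: "continuous_on S (osc n)"
  unfolding osc_def by (intro continuous_intros)

lemma osc_has_integral:
  assumes "n \<noteq> 0" "s \<le> t"
  shows "(osc n has_integral (osc n s - osc n t) / (3 * \<i> * of_int n)) {s..t}"
proof -
  have "((\<lambda>\<sigma>. - osc n \<sigma> / (3 * \<i> * of_int n)) has_vector_derivative osc n x) (at x within {s..t})" for x
    unfolding osc_def
    by (rule has_vector_derivative_real_field) (use assms in \<open>auto intro!: derivative_eq_intros\<close>)
  from fundamental_theorem_of_calculus[OF assms(2) this]
  show ?thesis by (simp add: diff_divide_distrib)
qed

lemma norm_integral_osc_le:
  assumes "n \<noteq> 0" "s \<le> t"
  shows "cmod (integral {s..t} (osc n)) \<le> 2 / (3 * \<bar>of_int n\<bar>)"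
proof -
  have "cmod (osc n s - osc n t) \<le> 2"
    using norm_triangle_ineq4[of "osc n s" "osc n t"] by simp
  then show ?thesis
    unfolding integral_unique[OF osc_has_integral[OF assms]]
    by (simp add: norm_divide norm_mult divide_right_mono)
qed

lemma Xdot_mult_osc: "Xdot_mult \<sigma> k k1 = \<i> * of_int k / 2 * osc (k * k1 * (k - k1)) \<sigma>"
  by (simp add: Xdot_mult_def osc_def)

lemma continuous_on_Xdot_mult [continuous_intros]: "continuous_on S (\<lambda>\<sigma>. Xdot_mult \<sigma> k k1)"
  unfolding Xdot_mult_osc by (intro continuous_intros)

text \<open>For nonzero \<open>k\<close> the prefactor \<open>k\<close> cancels against the phase.
  For \<open>k = 0\<close> both sides vanish: the prefactor is zero on the left, the phase on the
  right.\<close>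

lemma Xint_eq:
  assumes "s \<le> t" "k1 \<noteq> 0" "k - k1 \<noteq> 0"
  shows "Xint t s k k1 = (osc (k * k1 * (k - k1)) s - osc (k * k1 * (k - k1)) t) / of_int (6 * k1 * (k - k1))"
proof (cases "k = 0")
  case False
  then have "k * k1 * (k - k1) \<noteq> 0" using assms by simp
  from has_integral_mult_right[OF osc_has_integral[OF this assms(1)], of "\<i> * of_int k / 2"]
  have "Xint t s k k1 = \<i> * of_int k / 2 * ((osc (k * k1 * (k - k1)) s - osc (k * k1 * (k - k1)) t)
      / (3 * \<i> * of_int (k * k1 * (k - k1))))"
    unfolding Xint_def Xdot_mult_osc by (rule integral_unique)
  moreover have "\<i> * K / 2 * (D / (3 * \<i> * (K * A * B))) = D / (6 * A * B)"
    if "K \<noteq> 0" "A \<noteq> 0" "B \<noteq> 0" for K A B D :: complex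
    using that by (simp add: field_simps)
  ultimately show ?thesis using False assms(2,3) by (simp del: of_int_diff)
qed (simp add: Xint_def Xdot_mult_def)

lemma norm_Xint_le:
  assumes "s \<le> t" "k1 \<noteq> 0" "k - k1 \<noteq> 0"
  shows "cmod (Xint t s k k1) \<le> wt k1 * wt (k - k1)"
proof -
  \<comment> \<open>The wasteful constant 6 cancels the 6 in the denominator of
    \<open>Xint_eq\<close>.\<close>
  have "cmod (osc n s - osc n t) \<le> 6" for n
    using norm_triangle_ineq4[of "osc n s" "osc n t"] by simp
  then have "cmod (Xint t s k k1) \<le> 6 / \<bar>of_int (6 * k1 * (k - k1))\<bar>"
    unfolding Xint_eq[OF assms] norm_divide norm_of_int by (intro divide_right_mono) simp_all
  then show ?thesis by (simp add: wt_def abs_mult)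
qed

lemma Xint_has_vector_derivative:
  assumes "\<sigma> \<in> {s..t}"
  shows "((\<lambda>\<sigma>. Xint \<sigma> s k k1) has_vector_derivative Xdot_mult \<sigma> k k1) (at \<sigma> within {s..t})"
  unfolding Xint_def using continuous_on_Xdot_mult assms by (rule integral_has_vector_derivative)

lemma continuous_on_Xint [continuous_intros]: "continuous_on {s..t} (\<lambda>\<sigma>. Xint \<sigma> s k k1)"
  unfolding continuous_on_eq_continuous_within
  by (intro ballI has_vector_derivative_continuous[OF Xint_has_vector_derivative])

lemma X2_kernel_eq:
  "X2_kernel t s k k1 k3 = 2 * integral {s..t} (\<lambda>\<sigma>. Xdot_mult \<sigma> k k1 * Xint \<sigma> s (k - k1) k3)"
  unfolding X2_kernel_def Xint_def by simp

text \<open>All three phases equal \<open>m * a * (m + a)\<close>, so only the prefactors matter,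
  and \<open>- a + (m + a) = m\<close>.\<close>

lemma Xdot_mult_antisym:
  "Xdot_mult \<sigma> (- a) (- m - a) + Xdot_mult \<sigma> (m + a) a = - Xdot_mult \<sigma> (- m) a"
proof -
  have "- a * (- m - a) * (- a - (- m - a)) = - m * a * (- m - a)"
    "(m + a) * a * (m + a - a) = - m * a * (- m - a)"
    by (simp_all add: algebra_simps)
  then show ?thesis
    unfolding Xdot_mult_osc by (simp add: algebra_simps add_divide_distrib)
qed

text \<open>Both kernels have intermediate frequency \<open>m\<close> and share the inner factor
  \<open>Xint \<sigma> s m b\<close>; the antisymmetry acts on the outer factor alone.\<close>

lemma X2_kernel_antisym:
  "X2_kernel t s (- a) (- m - a) b + X2_kernel t s (m + a) a b
    = - 2 * integral {s..t} (\<lambda>\<sigma>. Xdot_mult \<sigma> (- m) a * Xint \<sigma> s m b)"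
proof -
  have i: "(\<lambda>\<sigma>. Xdot_mult \<sigma> k k1 * Xint \<sigma> s m b) integrable_on {s..t}" for k k1
    by (intro integrable_continuous_real continuous_intros)
  have "X2_kernel t s (- a) (- m - a) b + X2_kernel t s (m + a) a b
    = 2 * integral {s..t} (\<lambda>\<sigma>. (Xdot_mult \<sigma> (- a) (- m - a) + Xdot_mult \<sigma> (m + a) a) * Xint \<sigma> s m b)"
    unfolding X2_kernel_eq distrib_right integral_add[OF i i] by (simp add: distrib_left)
  then show ?thesis unfolding Xdot_mult_antisym by simp
qed

text \<open>The second pair arises from the first by $(m,a,b) \mapsto (-m,b,a)$, which exchanges the roles of
  the two time variables; the two triangles $\sigma_1 < \sigma$ and $\sigma < \sigma_1$ make up a square.\<close>

lemma X2_kernel_symmetrized: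
  assumes "s \<le> t"
  shows "X2_kernel t s (- a) (- m - a) b + X2_kernel t s (m + a) a b
       + (X2_kernel t s (- b) (m - b) a + X2_kernel t s (b - m) b a)
    = - 2 * (Xint t s (- m) a * Xint t s m b)"
proof -
  have i: "(\<lambda>\<sigma>. Xdot_mult \<sigma> k k1 * Xint \<sigma> s m b) integrable_on {s..t}" for k k1 m b
    by (intro integrable_continuous_real continuous_intros)
  \<comment> \<open>The two triangle integrals are the two terms of the product rule for a product
    of primitives, so together they give its increment.\<close>
  have "((\<lambda>\<sigma>. Xdot_mult \<sigma> (- m) a * Xint \<sigma> s m b + Xdot_mult \<sigma> m b * Xint \<sigma> s (- m) a)
    has_integral Xint t s (- m) a * Xint t s m b - Xint s s (- m) a * Xint s s m b) {s..t}"
  proof (rule fundamental_theorem_of_calculus[OF assms])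
    show "((\<lambda>\<sigma>. Xint \<sigma> s (- m) a * Xint \<sigma> s m b) has_vector_derivative
      Xdot_mult \<sigma> (- m) a * Xint \<sigma> s m b + Xdot_mult \<sigma> m b * Xint \<sigma> s (- m) a) (at \<sigma> within {s..t})"
      if "\<sigma> \<in> {s..t}" for \<sigma>
      using has_vector_derivative_mult[OF Xint_has_vector_derivative[OF that, of "- m" a]
          Xint_has_vector_derivative[OF that, of m b]] by (simp add: algebra_simps)
  qed
  moreover have "Xint s s (- m) a = 0" by (simp add: Xint_def)
  ultimately have "integral {s..t} (\<lambda>\<sigma>. Xdot_mult \<sigma> (- m) a * Xint \<sigma> s m b)
      + integral {s..t} (\<lambda>\<sigma>. Xdot_mult \<sigma> m b * Xint \<sigma> s (- m) a) = Xint t s (- m) a * Xint t s m b"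
    unfolding integral_add[OF i i, symmetric] by (simp add: integral_unique)
  then show ?thesis
    using X2_kernel_antisym[of t s a m b] X2_kernel_antisym[of t s b "- m" a]
    by (simp flip: \<open>_ = Xint t s (- m) a * Xint t s m b\<close>)
qed

section \<open>Bounds on the kernel of X^2\<close>

lemma abs_int_le_mult: "\<bar>m + n\<bar> \<le> 2 * (\<bar>m\<bar> * \<bar>n\<bar>)" if "m \<noteq> 0" "n \<noteq> 0" for m n :: int
proof -
  have "1 \<le> \<bar>m\<bar>" "1 \<le> \<bar>n\<bar>" using that by auto
  then have "\<bar>m\<bar> * 1 \<le> \<bar>m\<bar> * \<bar>n\<bar>" "1 * \<bar>n\<bar> \<le> \<bar>m\<bar> * \<bar>n\<bar>"
    by (intro mult_mono; simp)+
  then show ?thesis using abs_triangle_ineq[of m n] by linarith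
qed

text \<open>The product of the two oscillations has phase $k_2 (k k_1 + k_3 k_4)$, which factorises as
  $k_2 (k_1 + k_3)(k_1 + k_4)$; the resonances are $k_3 = -k_1$ and $k_4 = -k_1$.\<close>

lemma X2_kernel_decomp:
  assumes "s \<le> t" "k3 \<noteq> 0" "k4 \<noteq> 0" "k2 \<noteq> 0" "k = k1 + k2" "k2 = k3 + k4"
  shows "X2_kernel t s k k1 k3 = \<i> * of_int k / of_int (6 * k3 * k4) *
    (osc (k2 * k3 * k4) s * integral {s..t} (osc (k * k1 * k2))
      - integral {s..t} (osc (k2 * (k1 + k3) * (k1 + k4))))"
proof -
  let ?c = "\<i> * of_int k / 2 / of_int (6 * k3 * k4)"
  have k: "k - k1 = k2" "k2 - k3 = k4" using assms by auto
  \<comment> \<open>The upper boundary term of the inner integral adds its phase to the outer one;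
    the lower boundary term is constant in \<open>\<sigma>\<close>.\<close>
  have e: "k * k1 * k2 + k2 * k3 * k4 = k2 * (k1 + k3) * (k1 + k4)"
    using assms by (simp add: algebra_simps)
  have p: "Xdot_mult \<sigma> k k1 * Xint \<sigma> s (k - k1) k3
    = ?c * (osc (k2 * k3 * k4) s * osc (k * k1 * k2) \<sigma> - osc (k2 * (k1 + k3) * (k1 + k4)) \<sigma>)"
    if "\<sigma> \<in> {s..t}" for \<sigma>
  proof -
    have X: "Xint \<sigma> s k2 k3 = (osc (k2 * k3 * k4) s - osc (k2 * k3 * k4) \<sigma>) / of_int (6 * k3 * k4)"
      using that assms(2,3) Xint_eq[of s \<sigma> k3 k2] unfolding k by simp
    show ?thesis
      unfolding Xdot_mult_osc k e[symmetric] osc_add X by (simp add: right_diff_distrib diff_divide_distrib ac_simps)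
  qed
  have i: "osc n integrable_on {s..t}" for n
    by (intro integrable_continuous_real continuous_intros)
  have "integral {s..t} (\<lambda>\<sigma>. Xdot_mult \<sigma> k k1 * Xint \<sigma> s (k - k1) k3)
    = integral {s..t} (\<lambda>\<sigma>. ?c * (osc (k2 * k3 * k4) s * osc (k * k1 * k2) \<sigma> - osc (k2 * (k1 + k3) * (k1 + k4)) \<sigma>))"
    using p by (rule integral_cong)
  also have "\<dots> = ?c * (osc (k2 * k3 * k4) s * integral {s..t} (osc (k * k1 * k2))
      - integral {s..t} (osc (k2 * (k1 + k3) * (k1 + k4))))"
    using i by (simp add: integral_diff integrable_on_mult_right)
  finally show ?thesis unfolding X2_kernel_eq by (simp add: mult.assoc)
qed

text \<open>The factor $k$ is absorbed by $|k| \<le> 2 |k_1 + k_3| |k_4|$ away from the resonances; on the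
  resonances $k_3 = -k_1$ and $k_4 = -k_1$ (that is, $k_3 = k$) one has $|k| \<le> |k_3 k_4|$.\<close>

lemma norm_X2_kernel_le:
  assumes "s \<le> t" "k1 \<noteq> 0" "k3 \<noteq> 0" "k - k1 - k3 \<noteq> 0"
  shows "cmod (X2_kernel t s k k1 k3) \<le> wt k1 * wt k3 * wt (k - k1 - k3)
     + wt k3 * wt (k - k1) * wt (k - k3) + (if k3 = - k1 \<or> k3 = k then t - s else 0)"
proof (cases "k = 0 \<or> k - k1 = 0")
  \<comment> \<open>One of the prefactors \<open>k\<close> and \<open>k - k1\<close> vanishes, so
    the kernel is zero.\<close>
  case True
  then show ?thesis using assms(1)
    by (auto simp: X2_kernel_def Xdot_mult_def wt_nonneg)
next
  case False
  define k2 k4 where k: "k2 = k - k1" "k4 = k - k1 - k3"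
  let ?A = "integral {s..t} (osc (k * k1 * k2))"
  let ?B = "integral {s..t} (osc (k2 * (k1 + k3) * (k1 + k4)))"
  let ?d = "\<bar>real_of_int k\<bar> / (6 * \<bar>of_int k3\<bar> * \<bar>of_int k4\<bar>)"
  have nz: "k \<noteq> 0" "k1 \<noteq> 0" "k2 \<noteq> 0" "k3 \<noteq> 0" "k4 \<noteq> 0" using False assms k by auto
  have d: "0 \<le> ?d" by simp
  have "X2_kernel t s k k1 k3 = \<i> * of_int k / of_int (6 * k3 * k4) * (osc (k2 * k3 * k4) s * ?A - ?B)"
    using assms(1) nz(4,5,3) by (rule X2_kernel_decomp) (simp_all add: k)
  then have "cmod (X2_kernel t s k k1 k3) = ?d * cmod (osc (k2 * k3 * k4) s * ?A - ?B)"
    by (simp add: norm_mult norm_divide abs_mult)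
  also have "\<dots> \<le> ?d * (cmod ?A + cmod ?B)"
    using norm_triangle_ineq4[of "osc (k2 * k3 * k4) s * ?A" ?B]
    by (intro mult_left_mono d) (simp add: norm_mult)
  also have "\<dots> = ?d * cmod ?A + ?d * cmod ?B" by (rule distrib_left)
  also have "?d * cmod ?A \<le> wt k1 * wt k3 * wt k4"
  proof -
    \<comment> \<open>Integration gains a denominator \<open>k * k1 * k2\<close>; its
      \<open>k\<close> cancels the one in \<open>?d\<close>, and the spare weight of
      \<open>k2\<close> is at most 1.\<close>
    have "?d * cmod ?A \<le> ?d * (2 / (3 * \<bar>of_int (k * k1 * k2)\<bar>))"
      using nz assms(1) by (intro mult_left_mono norm_integral_osc_le d) auto
    also have "\<dots> = wt k1 * wt k3 * wt k4 * (wt k2 / 9)"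
      using nz by (simp add: wt_def abs_mult)
    also have "\<dots> \<le> wt k1 * wt k3 * wt k4 * 1"
      using nz by (intro mult_left_mono mult_nonneg_nonneg wt_nonneg) (auto simp: wt_def field_simps)
    finally show ?thesis by simp
  qed
  also have "?d * cmod ?B \<le> wt k3 * wt k2 * wt (k - k3) + (if k3 = - k1 \<or> k3 = k then t - s else 0)"
  proof (cases "k3 = - k1 \<or> k3 = k")
    case True
    then have 0: "k2 * (k1 + k3) * (k1 + k4) = 0" using k by auto
    \<comment> \<open>One of \<open>k3\<close>, \<open>k4\<close> equals \<open>k\<close> here, and
      the other is a nonzero integer.\<close>
    have "\<bar>k\<bar> \<le> \<bar>k3\<bar> * \<bar>k4\<bar>"
      using True k nz by (auto simp: mult_le_cancel_left1 mult_le_cancel_right1)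
    then have "\<bar>real_of_int k\<bar> \<le> \<bar>of_int k3\<bar> * \<bar>of_int k4\<bar>"
      by (metis of_int_abs of_int_le_iff of_int_mult)
    then have "?d \<le> 1" using nz by (auto simp: divide_le_eq)
    moreover have "osc 0 = (\<lambda>_. 1)" by (simp add: fun_eq_iff)
    then have "cmod ?B = t - s" unfolding 0 using assms(1) by simp
    ultimately have "?d * cmod ?B \<le> t - s"
      using mult_left_le_one_le[of "t - s" ?d] assms(1) d by simp
    then show ?thesis using True
      by (simp add: add_increasing mult_nonneg_nonneg wt_nonneg)
  next
    case False
    then have nr: "k1 + k3 \<noteq> 0" "k1 + k4 \<noteq> 0" using k by auto
    \<comment> \<open>Here \<open>k = (k1 + k3) + k4\<close>; the remaining factor
      \<open>k1 + k4\<close> is \<open>k - k3\<close>.\<close>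
    have "\<bar>k\<bar> \<le> 2 * (\<bar>k1 + k3\<bar> * \<bar>k4\<bar>)"
      using abs_int_le_mult[OF nr(1) nz(5)] k by simp
    then have "of_int \<bar>k\<bar> \<le> real_of_int (2 * (\<bar>k1 + k3\<bar> * \<bar>k4\<bar>))"
      by (simp only: of_int_le_iff)
    then have kb: "\<bar>real_of_int k\<bar> \<le> 2 * (\<bar>of_int (k1 + k3)\<bar> * \<bar>of_int k4\<bar>)" by simp
    have "?d * cmod ?B \<le> ?d * (2 / (3 * \<bar>of_int (k2 * (k1 + k3) * (k1 + k4))\<bar>))"
      using nz nr assms(1) by (intro mult_left_mono norm_integral_osc_le d) auto
    also have "\<dots> = \<bar>real_of_int k\<bar> / (9 * (\<bar>of_int (k1 + k3)\<bar> * \<bar>of_int k4\<bar>)) * (wt k3 * wt k2 * wt (k1 + k4))"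
      by (simp add: wt_def abs_mult)
    also have "\<dots> \<le> 1 * (wt k3 * wt k2 * wt (k1 + k4))"
      using kb nz nr by (intro mult_right_mono mult_nonneg_nonneg wt_nonneg) (simp add: divide_le_eq)
    finally show ?thesis using False k by simp
  qed
  finally show ?thesis unfolding k by simp
qed

subsection \<open>Absolute convergence\<close>

lemma abs_summable_by_comparison:
  fixes f :: "'a \<Rightarrow> complex"
  assumes "g summable_on A" "\<And>x. x \<in> A \<Longrightarrow> cmod (f x) \<le> g x"
  shows "(\<lambda>x. cmod (f x)) summable_on A"
  using assms(1) by (rule summable_on_comparison_test) (auto intro: assms(2))

lemma fibre_sums_abs_summable:
  fixes f :: "'a \<times> 'b \<Rightarrow> complex"
  assumes "(\<lambda>p. cmod (f p)) summable_on UNIV"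
  shows "(\<lambda>x. cmod (\<Sum>\<^sub>\<infinity>y. f (x, y))) summable_on UNIV"
    and "(\<lambda>y. cmod (f (x, y))) summable_on UNIV"
    and "(\<Sum>\<^sub>\<infinity>x. \<Sum>\<^sub>\<infinity>y. f (x, y)) = infsum f UNIV"
proof -
  have *: "(\<lambda>p. cmod (f p)) summable_on (SIGMA x:UNIV. UNIV)" using assms by simp
  note fib = *[unfolded Infinite_Sum.abs_summable_on_Sigma_iff]
  show 1: "(\<lambda>y. cmod (f (x, y))) summable_on UNIV" for x using fib by simp
  have "(\<lambda>x. \<Sum>\<^sub>\<infinity>y. cmod (f (x, y))) summable_on UNIV"
    using fib by (simp add: infsum_nonneg)
  then show "(\<lambda>x. cmod (\<Sum>\<^sub>\<infinity>y. f (x, y))) summable_on UNIV"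
    by (rule abs_summable_by_comparison) (intro norm_infsum_bound 1)
  show "(\<Sum>\<^sub>\<infinity>x. \<Sum>\<^sub>\<infinity>y. f (x, y)) = infsum f UNIV"
    using infsum_Sigma_banach[OF abs_summable_summable[OF *]] by simp
qed

lemma wt_mult_summable:
  "l2 \<phi> \<Longrightarrow> (\<lambda>k. wt k * cmod (\<phi> k)) summable_on UNIV"
  using wt_shift_bound(1)[of \<phi> 0] by simp

text \<open>The output frequency comes first: summing over the other indices gives a Fourier
  coefficient, while the whole index set can be reindexed by bijections.\<close>

definition xterm :: "real \<Rightarrow> real \<Rightarrow> fcoef \<Rightarrow> int \<times> int \<Rightarrow> complex" where
  "xterm t s \<phi> = (\<lambda>(k, k1). Xint t s k k1 * \<phi> k1 * \<phi> (k - k1))"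

definition x2term :: "real \<Rightarrow> real \<Rightarrow> fcoef \<Rightarrow> int \<times> int \<times> int \<Rightarrow> complex" where
  "x2term t s \<phi> = (\<lambda>(k, k1, k3). X2_kernel t s k k1 k3 * \<phi> k1 * \<phi> k3 * \<phi> (k - k1 - k3))"

text \<open>In the variables \<open>k1\<close> and \<open>k - k1\<close> the majorant is a product
  of two summable families.\<close>

lemma xterm_summable:
  assumes "\<phi> \<in> L2_0" "s \<le> t"
  shows "(\<lambda>p. cmod (xterm t s \<phi> p)) summable_on UNIV"
proof -
  let ?f = "\<lambda>k. wt k * cmod (\<phi> k)"
  note S = wt_mult_summable[OF L2_0_l2[OF assms(1)]]
  have "(\<lambda>(k1, k2). ?f k1 * ?f k2) summable_on UNIV"
    using S by (intro summable_on_times_bounded[OF _ _ _ _ order_refl]) (auto simp: wt_nonneg)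
  moreover have "bij (\<lambda>(k::int, k1). (k1, k - k1))"
    by (rule bij_betw_byWitness[of _ "\<lambda>(k1, k2). (k1 + k2, k1)"]) auto
  ultimately have "(\<lambda>p. case (case p of (k, k1) \<Rightarrow> (k1, k - k1)) of (k1, k2) \<Rightarrow> ?f k1 * ?f k2) summable_on UNIV"
    by (subst summable_on_reindex_bij_betw)
  then show ?thesis
  proof (rule abs_summable_by_comparison)
    fix p :: "int \<times> int"
    obtain k k1 where p: "p = (k, k1)" by force
    show "cmod (xterm t s \<phi> p) \<le> (case (case p of (k, k1) \<Rightarrow> (k1, k - k1)) of (k1, k2) \<Rightarrow> ?f k1 * ?f k2)"
    proof (cases "k1 = 0 \<or> k - k1 = 0")
      case True
      then show ?thesis
        using L2_0_zero[OF assms(1)] by (auto simp: xterm_def p wt_nonneg)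
    next
      case False
      have "cmod (Xint t s k k1) * (cmod (\<phi> k1) * cmod (\<phi> (k - k1)))
        \<le> (wt k1 * wt (k - k1)) * (cmod (\<phi> k1) * cmod (\<phi> (k - k1)))"
        using False by (intro mult_right_mono norm_Xint_le assms) auto
      then show ?thesis by (simp add: p xterm_def norm_mult mult_ac)
    qed
  qed
qed

text \<open>Because $\varphi_0 = 0$, the sums may run over all frequencies: the terms excluded in
  \<^const>\<open>Xop\<close> and \<^const>\<open>X2op\<close> vanish.\<close>

lemma Xop_eq:
  assumes "\<phi> \<in> L2_0" "s \<le> t"
  shows "Xop t s \<phi> \<phi> k = (\<Sum>\<^sub>\<infinity>k1. xterm t s \<phi> (k, k1))"
  unfolding Xop_def
proof (rule infsum_cong_neutral)
  show "xterm t s \<phi> (k, k1) = 0" if "k1 \<in> UNIV - (UNIV - {0, k})" for k1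
    using that L2_0_zero[OF assms(1)] by (auto simp: xterm_def)
qed (auto simp: xterm_def Xint_eq[OF assms(2)] osc_def)

lemma l2_Xop:
  assumes "\<phi> \<in> L2_0" "s \<le> t" shows "l2 (Xop t s \<phi> \<phi>)"
  unfolding Xop_eq[OF assms, abs_def]
  by (rule l2_if_abs_summable[OF fibre_sums_abs_summable(1)[OF xterm_summable[OF assms]]])

section \<open>Resonant and nonresonant parts of X^2\<close>

text \<open>Meant for the resonances, which confine \<open>(k1, k3)\<close> to the graph of a
  function of \<open>k1\<close>.\<close>

lemma infsum_graph:
  fixes q :: "'a \<Rightarrow> real"
  assumes "q summable_on UNIV"
  shows "((\<lambda>(x, y). if y = h x then q x else 0) has_sum infsum q UNIV) UNIV"
proof -
  have "((\<lambda>(x, y). if y = h x then q x else 0) has_sum infsum q UNIV) ((\<lambda>x. (x, h x)) ` UNIV)"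
    by (subst has_sum_reindex) (auto simp: inj_on_def o_def has_sum_infsum[OF assms])
  then show ?thesis by (rule has_sum_cong_neutral[THEN iffD1, rotated -1]) auto
qed

definition nonres :: "fcoef \<Rightarrow> int \<times> int \<times> int \<Rightarrow> real" where
  "nonres \<phi> = (\<lambda>(k, k1, k3).
     (wt k1 * wt k3 * wt (k - k1 - k3) + wt k3 * wt (k - k1) * wt (k - k3))
     * (cmod (\<phi> k1) * cmod (\<phi> k3) * cmod (\<phi> (k - k1 - k3))))"

text \<open>On either resonance the three coefficients have product of modulus
  \<open>cmod (\<phi> k) * (cmod (\<phi> k1))\<^sup>2\<close>; the factor
  \<open>cmod (\<phi> k)\<close> is kept outside. Where both resonances meet, both summands count,
  which is harmless in an upper bound.\<close>

definition res :: "real \<Rightarrow> fcoef \<Rightarrow> int \<Rightarrow> int \<times> int \<Rightarrow> real" where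
  "res \<tau> \<phi> k = (\<lambda>(k1, k3). \<tau> * ((if k3 = - k1 then (cmod (\<phi> k1))\<^sup>2 else 0) + (if k3 = k then (cmod (\<phi> k1))\<^sup>2 else 0)))"

text \<open>Each resonance contributes a full sum of squares. Independence of \<open>k\<close> makes
  the resonant bound a multiple of \<open>cmod (\<phi> k)\<close>.\<close>

lemma res_has_sum:
  assumes "l2 \<phi>" shows "(res \<tau> \<phi> k has_sum 2 * \<tau> * sqnorm \<phi>) UNIV"
proof -
  have "((\<lambda>p. \<tau> * ((case p of (k1, k3) \<Rightarrow> if k3 = - k1 then (cmod (\<phi> k1))\<^sup>2 else 0)
     + (case p of (k1, k3) \<Rightarrow> if k3 = k then (cmod (\<phi> k1))\<^sup>2 else 0))) has_sum \<tau> * (sqnorm \<phi> + sqnorm \<phi>)) UNIV"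
    unfolding sqnorm_def using assms unfolding l2_def
    by (intro has_sum_cmult_right has_sum_add infsum_graph)
  then show ?thesis unfolding res_def by (simp add: case_prod_unfold mult_ac)
qed

lemma res_nonneg: "0 \<le> \<tau> \<Longrightarrow> 0 \<le> res \<tau> \<phi> k p"
  by (simp add: res_def case_prod_unfold)

text \<open>With $a = k_3$, $b = k_3 + k_4$ and $c = k_1 + k_4$ the second summand of the kernel bound becomes
  $|\varphi_a||\varphi_{b-a}||\varphi_{c+a-b}| / |abc|$, to be summed over $c$, then $b$, then $a$.\<close>

lemma nonres_summable:
  assumes "l2 \<phi>" shows "nonres \<phi> summable_on UNIV"
proof -
  let ?f = "\<lambda>k. wt k * cmod (\<phi> k)"
  let ?g = "\<lambda>n k. wt k * cmod (\<phi> (k + n))"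
  note S = wt_mult_summable[OF assms]
  obtain C where C: "\<And>n. infsum (?g n) UNIV \<le> C" using wt_shift_bound(2)[OF assms] by blast
  have s2: "(\<lambda>(k1, k3). ?f k1 * ?f k3) summable_on UNIV"
    using S by (intro summable_on_times_bounded[OF _ _ _ _ order_refl]) (auto simp: wt_nonneg)
  have "(\<lambda>(p, k4). (case p of (k1, k3) \<Rightarrow> ?f k1 * ?f k3) * ?f k4) summable_on UNIV"
    by (rule summable_on_times_bounded[OF s2 _ S _ order_refl]) (auto simp: wt_nonneg)
  moreover have "bij (\<lambda>(k::int, k1::int, k3). ((k1, k3), k - k1 - k3))"
    by (rule bij_betw_byWitness[of _ "\<lambda>((k1, k3), k4). (k1 + k3 + k4, k1, k3)"]) auto
  ultimately have A: "(\<lambda>q. case (case q of (k, k1, k3) \<Rightarrow> ((k1, k3), k - k1 - k3)) of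
      (p, k4) \<Rightarrow> (case p of (k1, k3) \<Rightarrow> ?f k1 * ?f k3) * ?f k4) summable_on UNIV"
    by (subst summable_on_reindex_bij_betw)
  have s2: "(\<lambda>(a, b). ?f a * ?g (- a) b) summable_on UNIV"
    by (rule summable_on_times_bounded[OF S _ wt_shift_bound(1)[OF assms] _ C]) (auto simp: wt_nonneg)
  have "(\<lambda>(p, c). (case p of (a, b) \<Rightarrow> ?f a * ?g (- a) b) * (case p of (a, b) \<Rightarrow> ?g (a - b)) c) summable_on UNIV"
    by (rule summable_on_times_bounded[OF s2, where C = C])
      (auto simp: wt_nonneg intro: wt_shift_bound(1)[OF assms] C)
  moreover have "bij (\<lambda>(k::int, k1::int, k3). ((k3, k - k1), k - k3))"
    by (rule bij_betw_byWitness[of _ "\<lambda>((a, b), c). (a + c, a + c - b, a)"]) auto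
  ultimately have B: "(\<lambda>q. case (case q of (k, k1, k3) \<Rightarrow> ((k3, k - k1), k - k3)) of
      (p, c) \<Rightarrow> (case p of (a, b) \<Rightarrow> ?f a * ?g (- a) b) * (case p of (a, b) \<Rightarrow> ?g (a - b)) c) summable_on UNIV"
    by (subst summable_on_reindex_bij_betw)
  show ?thesis
    using summable_on_add[OF A B]
    by (rule summable_on_cong[THEN iffD1, rotated]) (auto simp: nonres_def algebra_simps)
qed

lemma nonres_nonneg: "0 \<le> nonres \<phi> p"
  by (simp add: nonres_def case_prod_unfold wt_nonneg)

lemma norm_x2term_le:
  assumes "\<phi> \<in> L2_0" "s \<le> t"
  shows "cmod (x2term t s \<phi> (k, p)) \<le> nonres \<phi> (k, p) + cmod (\<phi> k) * res (t - s) \<phi> k p"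
proof -
  obtain k1 k3 where p: "p = (k1, k3)" by force
  have rn: "0 \<le> res (t - s) \<phi> k p" using assms(2) by (intro res_nonneg) simp
  show ?thesis
  proof (cases "k1 = 0 \<or> k3 = 0 \<or> k - k1 - k3 = 0")
    case True
    then have "x2term t s \<phi> (k, p) = 0"
      using L2_0_zero[OF assms(1)] by (auto simp: x2term_def p)
    then show ?thesis using nonres_nonneg rn by simp
  next
    case False
    let ?P = "cmod (\<phi> k1) * cmod (\<phi> k3) * cmod (\<phi> (k - k1 - k3))"
    let ?R = "if k3 = - k1 \<or> k3 = k then t - s else 0"
    have n: "cmod (\<phi> (- j)) = cmod (\<phi> j)" for j using L2_0_uminus[OF assms(1)] by simp
    have "cmod (x2term t s \<phi> (k, p)) = cmod (X2_kernel t s k k1 k3) * ?P"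
      by (simp add: x2term_def p norm_mult mult_ac)
    also have "\<dots> \<le> (wt k1 * wt k3 * wt (k - k1 - k3) + wt k3 * wt (k - k1) * wt (k - k3) + ?R) * ?P"
      using False assms(2) by (intro mult_right_mono norm_X2_kernel_le) auto
    also have "\<dots> = nonres \<phi> (k, p) + ?R * ?P" by (simp add: nonres_def p distrib_right)
    also have "?R * ?P \<le> cmod (\<phi> k) * res (t - s) \<phi> k p"
    proof -
      have d: "0 \<le> t - s" using assms(2) by simp
      have "(cmod (\<phi> k1))\<^sup>2 * (t - s) \<le> res (t - s) \<phi> k p" if "k3 = - k1 \<or> k3 = k"
        using that d by (auto simp: res_def p mult.commute)
      from mult_left_mono[OF this norm_ge_zero[of "\<phi> k"]]
      have "(t - s) * (cmod (\<phi> k) * (cmod (\<phi> k1))\<^sup>2) \<le> cmod (\<phi> k) * res (t - s) \<phi> k p"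
        if "k3 = - k1 \<or> k3 = k" using that by (simp add: mult_ac)
      moreover have "?P = cmod (\<phi> k) * (cmod (\<phi> k1))\<^sup>2" if "k3 = - k1 \<or> k3 = k"
        using that n by (auto simp: power2_eq_square)
      ultimately show ?thesis using rn by simp
    qed
    finally show ?thesis by simp
  qed
qed

text \<open>The resonant bound, a multiple of \<open>cmod (\<phi> k)\<close>, is square-summable in
  \<open>k\<close> but need not be summable. Hence \<open>k\<close> is fixed, and the second claim
  keeps that part separate.\<close>

lemma x2term_summable_fibre:
  assumes "\<phi> \<in> L2_0" "s \<le> t"
  shows "(\<lambda>p. cmod (x2term t s \<phi> (k, p))) summable_on UNIV"
    and "cmod (\<Sum>\<^sub>\<infinity>p. x2term t s \<phi> (k, p))
      \<le> (\<Sum>\<^sub>\<infinity>p. nonres \<phi> (k, p)) + cmod (\<phi> k) * (2 * (t - s) * sqnorm \<phi>)"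
proof -
  have l: "l2 \<phi>" by (rule L2_0_l2[OF assms(1)])
  have n: "(\<lambda>p. nonres \<phi> (k, p)) summable_on UNIV"
    using fibre_sums_abs_summable(2)[of "\<lambda>p. of_real (nonres \<phi> p)"] nonres_summable[OF l]
    by (simp add: nonres_nonneg)
  note r = has_sum_cmult_right[OF res_has_sum[OF l], of "cmod (\<phi> k)"]
  note N = summable_on_add[OF n has_sum_imp_summable[OF r]]
  show 1: "(\<lambda>p. cmod (x2term t s \<phi> (k, p))) summable_on UNIV"
    using N by (rule abs_summable_by_comparison) (rule norm_x2term_le[OF assms])
  have "cmod (\<Sum>\<^sub>\<infinity>p. x2term t s \<phi> (k, p)) \<le> (\<Sum>\<^sub>\<infinity>p. cmod (x2term t s \<phi> (k, p)))"
    by (rule norm_infsum_bound[OF 1])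
  also have "\<dots> \<le> (\<Sum>\<^sub>\<infinity>p. nonres \<phi> (k, p) + cmod (\<phi> k) * res (t - s) \<phi> k p)"
    by (intro infsum_mono 1 N norm_x2term_le[OF assms])
  also have "\<dots> = (\<Sum>\<^sub>\<infinity>p. nonres \<phi> (k, p)) + cmod (\<phi> k) * (2 * (t - s) * sqnorm \<phi>)"
    using infsum_add[OF n has_sum_imp_summable[OF r]] infsumI[OF r] by simp
  finally show "cmod (\<Sum>\<^sub>\<infinity>p. x2term t s \<phi> (k, p))
      \<le> (\<Sum>\<^sub>\<infinity>p. nonres \<phi> (k, p)) + cmod (\<phi> k) * (2 * (t - s) * sqnorm \<phi>)" .
qed

lemma X2op_eq:
  assumes "\<phi> \<in> L2_0"
  shows "X2op t s \<phi> \<phi> \<phi> k = (\<Sum>\<^sub>\<infinity>p. x2term t s \<phi> (k, p))"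
  unfolding X2op_def
proof (rule infsum_cong_neutral)
  fix p :: "int \<times> int"
  assume "p \<in> UNIV - {(k1, k3). k1 \<noteq> 0 \<and> k1 \<noteq> k \<and> k3 \<noteq> 0 \<and> k3 \<noteq> k - k1}"
  then show "x2term t s \<phi> (k, p) = 0"
    using L2_0_zero[OF assms] by (auto simp: x2term_def X2_kernel_def Xdot_mult_def)
qed (auto simp: x2term_def)

text \<open>Square-summability matters beyond convergence: \<^const>\<open>L2norm\<close> is $0$ on families outside
  $\ell^2$, where the hypotheses on the remainders would be void.\<close>

lemma l2_X2op:
  assumes "\<phi> \<in> L2_0" "s \<le> t" shows "l2 (X2op t s \<phi> \<phi> \<phi>)"
proof (rule l2_comparison)
  let ?A = "\<lambda>k. \<Sum>\<^sub>\<infinity>p. nonres \<phi> (k, p)" and ?C = "2 * (t - s) * sqnorm \<phi>"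
  have l: "l2 \<phi>" by (rule L2_0_l2[OF assms(1)])
  have A0: "0 \<le> ?A k" for k by (intro infsum_nonneg nonres_nonneg)
  have C0: "0 \<le> ?C" using assms(2) by (simp add: sqnorm_nonneg)
  have "(\<lambda>k. ?A k) summable_on UNIV"
    using summable_on_Sigma_banach[of "\<lambda>k p. nonres \<phi> (k, p)" UNIV "\<lambda>_. UNIV"] nonres_summable[OF l]
    by simp
  then have "l2 (\<lambda>k. of_real (?A k))" by (intro l2_if_abs_summable) (simp add: A0)
  moreover have "l2 (\<lambda>k. of_real (cmod (\<phi> k)))" using l by (simp add: l2_def)
  \<comment> \<open>The majorant adds an absolutely summable part from \<open>nonres\<close> and a
    multiple of the modulus of \<open>\<phi>\<close> from the resonances.\<close>
  ultimately show "l2 (\<lambda>k. of_real (?A k) + of_real ?C * of_real (cmod (\<phi> k)))"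
    by (intro l2_add l2_scale)
  show "cmod (X2op t s \<phi> \<phi> \<phi> k) \<le> cmod (of_real (?A k) + of_real ?C * of_real (cmod (\<phi> k)))" for k
  proof -
    have "cmod (of_real (?A k) + of_real ?C * of_real (cmod (\<phi> k))) = ?A k + ?C * cmod (\<phi> k)"
      unfolding of_real_mult[symmetric] of_real_add[symmetric] norm_of_real
      by (rule abs_of_nonneg[OF add_nonneg_nonneg[OF A0 mult_nonneg_nonneg[OF C0 norm_ge_zero]]])
    then show ?thesis
      using x2term_summable_fibre(2)[OF assms, of k] by (simp add: X2op_eq[OF assms(1)] mult_ac)
  qed
qed

text \<open>Pairing with \<open>\<phi>\<close> supplies a second factor
  \<open>cmod (\<phi> k)\<close>, so the resonant bound becomes summable in \<open>k\<close>. This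
  licenses the rearrangements in \<open>ip_X2op\<close>.\<close>

lemma weighted_x2term_summable:
  assumes "\<phi> \<in> L2_0" "s \<le> t"
  shows "(\<lambda>(k, p). cmod (\<phi> (- k) * x2term t s \<phi> (k, p))) summable_on UNIV"
proof -
  have l: "l2 \<phi>" by (rule L2_0_l2[OF assms(1)])
  have n: "cmod (\<phi> (- j)) = cmod (\<phi> j)" for j using L2_0_uminus[OF assms(1)] by simp
  have "(\<lambda>(k, p). (cmod (\<phi> k))\<^sup>2 * res (t - s) \<phi> k p) summable_on UNIV"
    using l assms(2) unfolding l2_def
    by (intro summable_on_times_bounded[where C = "2 * (t - s) * sqnorm \<phi>"])
      (auto simp: infsumI[OF res_has_sum[OF l]] intro: res_nonneg has_sum_imp_summable[OF res_has_sum[OF l]])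
  from summable_on_add[OF summable_on_cmult_right[OF nonres_summable[OF l], of "1 + sqnorm \<phi>"] this]
  have "(\<lambda>(k, p). (1 + sqnorm \<phi>) * nonres \<phi> (k, p) + (cmod (\<phi> k))\<^sup>2 * res (t - s) \<phi> k p) summable_on UNIV"
    by (simp add: case_prod_unfold)
  then have "(\<lambda>q. cmod (case q of (k, p) \<Rightarrow> \<phi> (- k) * x2term t s \<phi> (k, p))) summable_on UNIV"
  proof (rule abs_summable_by_comparison)
    fix q :: "int \<times> int \<times> int"
    obtain k p where q: "q = (k, p)" by (cases q)
    have "cmod (\<phi> k) * cmod (x2term t s \<phi> (k, p))
      \<le> cmod (\<phi> k) * nonres \<phi> (k, p) + cmod (\<phi> k) * (cmod (\<phi> k) * res (t - s) \<phi> k p)"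
      using mult_left_mono[OF norm_x2term_le[OF assms, of k p] norm_ge_zero[of "\<phi> k"]]
      by (simp add: distrib_left)
    also have "\<dots> \<le> (1 + sqnorm \<phi>) * nonres \<phi> (k, p) + (cmod (\<phi> k))\<^sup>2 * res (t - s) \<phi> k p"
      by (intro add_mono mult_right_mono cmod_le_sqnorm l nonres_nonneg) (simp add: power2_eq_square)
    finally show "cmod (case q of (k, p) \<Rightarrow> \<phi> (- k) * x2term t s \<phi> (k, p))
      \<le> (case q of (k, p) \<Rightarrow> (1 + sqnorm \<phi>) * nonres \<phi> (k, p) + (cmod (\<phi> k))\<^sup>2 * res (t - s) \<phi> k p)"
      by (simp add: q norm_mult n)
  qed
  then show ?thesis by (simp add: case_prod_unfold)
qed

subsection \<open>Cancellations and conservation of the norm\<close>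

text \<open>Realness turns the pairing into a sum over triples of frequencies adding up to zero.
  Cyclic shifts preserve this sum, and the three shifted terms cancel pointwise.\<close>

lemma ip_Xop_eq_0:
  assumes "\<phi> \<in> L2_0" "s \<le> t"
  shows "ip \<phi> (Xop t s \<phi> \<phi>) = 0"
proof -
  define h where "h = (\<lambda>(a, b). \<phi> a * xterm t s \<phi> (- a, b))"
  have l: "l2 \<phi>" by (rule L2_0_l2[OF assms(1)])
  have n: "cmod (\<phi> (- j)) = cmod (\<phi> j)" for j using L2_0_uminus[OF assms(1)] by simp
  have bn: "bij (\<lambda>(a::int, b::int). (- a, b))"
    by (rule bij_betw_byWitness[of _ "\<lambda>(a, b). (- a, b)"]) auto
  have w: "(\<lambda>p. cmod (case p of (k, k1) \<Rightarrow> \<phi> (- k) * xterm t s \<phi> (k, k1))) summable_on UNIV"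
    using summable_on_cmult_right[OF xterm_summable[OF assms], of "1 + sqnorm \<phi>"]
    by (rule abs_summable_by_comparison)
      (auto simp: norm_mult n intro!: mult_right_mono cmod_le_sqnorm l)
  have "ip \<phi> (Xop t s \<phi> \<phi>) = (\<Sum>\<^sub>\<infinity>k. \<Sum>\<^sub>\<infinity>k1. \<phi> (- k) * xterm t s \<phi> (k, k1))"
    unfolding ip_def Xop_eq[OF assms] L2_0_uminus[OF assms(1)] by (simp add: infsum_cmult_right')
  also have "\<dots> = (\<Sum>\<^sub>\<infinity>p. case p of (k, k1) \<Rightarrow> \<phi> (- k) * xterm t s \<phi> (k, k1))"
    using fibre_sums_abs_summable(3)[OF w] by simp
  also have "\<dots> = infsum h UNIV"
    using infsum_reindex_bij_betw[OF bn, of "\<lambda>(k, k1). \<phi> (- k) * xterm t s \<phi> (k, k1)"]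
    by (simp add: h_def case_prod_unfold)
  finally have ih: "ip \<phi> (Xop t s \<phi> \<phi>) = infsum h UNIV" .
  have sh: "h summable_on UNIV"
    using abs_summable_summable[OF w]
      summable_on_reindex_bij_betw[OF bn, of "\<lambda>(k, k1). \<phi> (- k) * xterm t s \<phi> (k, k1)"]
    by (simp add: h_def case_prod_unfold)
  \<comment> \<open>\<open>r\<close> is the cyclic shift of the triple
    \<open>(a, b, - a - b)\<close>, of which two entries are stored.\<close>
  define r where "r = (\<lambda>(a::int, b::int). (b, - a - b))"
  have br: "bij r"
    unfolding r_def by (rule bij_betw_byWitness[of _ "\<lambda>(a, b). (- a - b, a)"]) auto
  have brr: "bij (\<lambda>p. r (r p))" using bij_comp[OF br br] by (simp add: o_def)
  have cyc: "h p + h (r p) + h (r (r p)) = 0" for p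
  proof -
    obtain a b where p: "p = (a, b)" by (cases p)
    define c where c: "c = - a - b"
    have q: "r p = (b, c)" "r (b, c) = (c, a)" by (auto simp: r_def p c)
    show ?thesis
    proof (cases "a = 0 \<or> b = 0 \<or> c = 0")
      case True
      then show ?thesis unfolding q unfolding p using L2_0_zero[OF assms(1)] by (auto simp: h_def xterm_def c)
    next
      case False
      let ?n = "a * b * (a + b)"
      let ?P = "(osc ?n s - osc ?n t) * (\<phi> a * \<phi> b * \<phi> c)"
      \<comment> \<open>Phase and product of coefficients are cyclically invariant; only the
        denominator varies.\<close>
      have X: "h (x, y) = ?P / of_int (6 * y * z)"
        if "x \<noteq> 0" "y \<noteq> 0" "z \<noteq> 0" "x + y + z = 0" "- x * y * z = ?n" "\<phi> x * \<phi> y * \<phi> z = \<phi> a * \<phi> b * \<phi> c"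
        for x y z
      proof -
        have z: "- x - y = z" using that(4) by simp
        have "h (x, y) = (osc (- x * y * z) s - osc (- x * y * z) t) / of_int (6 * y * z) * (\<phi> x * \<phi> y * \<phi> z)"
          using that(2,3) Xint_eq[OF assms(2), of y "- x"] z by (simp add: h_def xterm_def)
        then show ?thesis unfolding that(5,6) by simp
      qed
      have "h p + h (r p) + h (r (r p)) = ?P / of_int (6 * b * c) + ?P / of_int (6 * c * a) + ?P / of_int (6 * a * b)"
        unfolding q unfolding p using False
        by (intro arg_cong2[of _ _ _ _ "(+)"] X) (auto simp: c algebra_simps)
      also have "\<dots> = ?P * of_int (a + b + c) / of_int (6 * a * b * c)"
        using False by (simp add: divide_simps) (simp add: algebra_simps)
      also have "a + b + c = 0" by (simp add: c)
      finally show ?thesis by simp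
    qed
  qed
  have s1: "(\<lambda>p. h (r p)) summable_on UNIV" "(\<lambda>p. h (r (r p))) summable_on UNIV"
    using summable_on_reindex_bij_betw[OF br, of h] summable_on_reindex_bij_betw[OF brr, of h] sh by simp_all
  have "infsum h UNIV + infsum h UNIV + infsum h UNIV
     = (\<Sum>\<^sub>\<infinity>p. h p + h (r p) + h (r (r p)))"
    unfolding infsum_add[OF summable_on_add[OF sh s1(1)] s1(2)] infsum_add[OF sh s1(1)]
      infsum_reindex_bij_betw[OF br] infsum_reindex_bij_betw[OF brr] ..
  then have "3 * infsum h UNIV = 0" unfolding cyc by simp
  then show ?thesis using ih by simp
qed

section \<open>The identity for X^2\<close>

lemma sqnorm_eq_ip: "of_real (sqnorm f) = ip f f" if "l2 f"
proof -
  have "cnj (f k) * f k = of_real ((cmod (f k))\<^sup>2)" for k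
    by (metis complex_norm_square mult.commute)
  moreover have "((\<lambda>k. complex_of_real ((cmod (f k))\<^sup>2)) has_sum of_real (sqnorm f)) UNIV"
    unfolding sqnorm_def using that[unfolded l2_def] by (intro has_sum_of_real has_sum_infsum)
  ultimately show ?thesis
    unfolding ip_def by (simp only: infsumI)
qed

lemma cnj_xterm:
  assumes "\<phi> \<in> L2_0" "s \<le> t"
  shows "cnj (xterm t s \<phi> (k, k1)) = xterm t s \<phi> (- k, - k1)"
proof (cases "k1 = 0 \<or> k - k1 = 0")
  case True
  then show ?thesis using L2_0_zero[OF assms(1)] by (auto simp: xterm_def)
next
  case False
  have u: "\<phi> (- j) = cnj (\<phi> j)" for j by (rule L2_0_uminus[OF assms(1)])
  have o: "cnj (osc n \<sigma>) = osc (- n) \<sigma>" for n \<sigma> by (simp add: osc_def exp_cnj)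
  have d: "- k - - k1 = - (k - k1)" by simp
  have "cnj (Xint t s k k1) = Xint t s (- k) (- k1)"
    using False by (subst (1 2) Xint_eq) (auto simp: assms o d simp del: of_int_diff minus_diff_eq diff_minus_eq_add)
  then show ?thesis by (simp add: xterm_def u d del: minus_diff_eq diff_minus_eq_add)
qed

text \<open>Conjugation reverses all frequencies of a term. The resulting realness of X lets the
  product of its coefficients at \<open>m\<close> and \<open>- m\<close> be read as a squared
  modulus.\<close>

lemma cnj_Xop:
  assumes "\<phi> \<in> L2_0" "s \<le> t"
  shows "cnj (Xop t s \<phi> \<phi> k) = Xop t s \<phi> \<phi> (- k)"
proof -
  have "cnj (Xop t s \<phi> \<phi> k) = (\<Sum>\<^sub>\<infinity>k1. xterm t s \<phi> (- k, - k1))"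
    unfolding Xop_eq[OF assms] by (simp flip: infsum_cnj add: cnj_xterm[OF assms])
  also have "\<dots> = (\<Sum>\<^sub>\<infinity>k1. xterm t s \<phi> (- k, k1))"
    by (rule infsum_reindex_bij_betw[OF bij_uminus])
  finally show ?thesis unfolding Xop_eq[OF assms] .
qed

text \<open>The quadruples $(-k, k_1, k_3, k_4)$ of sum zero are parametrised by $(m, a, b)$ as
  $(a, -m-a, b, m-b)$, where $m = k_2$ is the intermediate frequency.\<close>

lemma ip_X2op:
  assumes "\<phi> \<in> L2_0" "s \<le> t"
  shows "2 * ip \<phi> (X2op t s \<phi> \<phi> \<phi>) = - of_real (sqnorm (Xop t s \<phi> \<phi>))"
proof -
  define w where "w = (\<lambda>(k, p). \<phi> (- k) * x2term t s \<phi> (k, p))"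
  define c where "c = (\<lambda>(m::int, a::int, b::int). (- a, - m - a, b))"
  define H where "H = (\<lambda>q. w (c q))"
  define X where "X = (\<lambda>(m, a, b). xterm t s \<phi> (- m, a) * xterm t s \<phi> (m, b))"
  \<comment> \<open>On quadruples, \<open>T1\<close> swaps the first two entries (antisymmetry of
    the outer form) and \<open>T2\<close> swaps the two pairs (exchange of times). Both preserve the
    product of coefficients.\<close>
  define T1 where "T1 = (\<lambda>(m::int, a::int, b::int). (m, - m - a, b))"
  define T2 where "T2 = (\<lambda>(m::int, a::int, b::int). (- m, b, a))"
  have bc: "bij c"
    unfolding c_def by (rule bij_betw_byWitness[of _ "\<lambda>(k, k1, k3). (k - k1, - k, k3)"]) auto
  have b1: "bij T1"
    unfolding T1_def by (rule bij_betw_byWitness[of _ "\<lambda>(m, a, b). (m, - m - a, b)"]) auto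
  have b2: "bij T2"
    unfolding T2_def by (rule bij_betw_byWitness[of _ "\<lambda>(m, a, b). (- m, b, a)"]) auto
  have b12: "bij (\<lambda>q. T1 (T2 q))" using bij_comp[OF b2 b1] by (simp add: o_def)
  have ws: "(\<lambda>q. cmod (w q)) summable_on UNIV"
    using weighted_x2term_summable[OF assms] by (simp add: w_def case_prod_unfold)
  have "ip \<phi> (X2op t s \<phi> \<phi> \<phi>) = (\<Sum>\<^sub>\<infinity>k. \<Sum>\<^sub>\<infinity>p. w (k, p))"
    unfolding ip_def X2op_eq[OF assms(1)] w_def by (simp add: infsum_cmult_right' L2_0_uminus[OF assms(1)])
  also have "\<dots> = infsum w UNIV" by (rule fibre_sums_abs_summable(3)[OF ws])
  also have "\<dots> = infsum H UNIV" unfolding H_def using infsum_reindex_bij_betw[OF bc, of w] by simp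
  finally have ipH: "ip \<phi> (X2op t s \<phi> \<phi> \<phi>) = infsum H UNIV" .
  have HS: "H summable_on UNIV"
    unfolding H_def using summable_on_reindex_bij_betw[OF bc, of w] abs_summable_summable[OF ws] by simp
  have sym: "H q + H (T1 q) + (H (T2 q) + H (T1 (T2 q))) = - 2 * X q" for q
  proof -
    obtain m a b where q: "q = (m, a, b)" by (cases q)
    let ?P = "\<phi> a * \<phi> (- m - a) * \<phi> b * \<phi> (m - b)"
    have H: "H (m, a, b) = X2_kernel t s (- a) (- m - a) b * (\<phi> a * \<phi> (- m - a) * \<phi> b * \<phi> (m - b))" for m a b
      by (simp add: H_def w_def c_def x2term_def mult_ac)
    have "H (T1 q) = X2_kernel t s (m + a) a b * ?P"
      by (simp add: q T1_def H mult_ac add.commute)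
    moreover have "H (T2 q) = X2_kernel t s (- b) (m - b) a * ?P"
      by (simp add: q T2_def H mult_ac)
    moreover have "H (T1 (T2 q)) = X2_kernel t s (b - m) b a * ?P"
      by (simp add: q T1_def T2_def H mult_ac)
    ultimately have "H q + H (T1 q) + (H (T2 q) + H (T1 (T2 q)))
      = (X2_kernel t s (- a) (- m - a) b + X2_kernel t s (m + a) a b
       + (X2_kernel t s (- b) (m - b) a + X2_kernel t s (b - m) b a)) * ?P"
      by (simp only: q H distrib_right)
    also have "\<dots> = - 2 * X q"
      unfolding X2_kernel_symmetrized[OF assms(2)] by (simp add: q X_def xterm_def)
    finally show ?thesis .
  qed
  have S: "(\<lambda>q. H (T1 q)) summable_on UNIV" "(\<lambda>q. H (T2 q)) summable_on UNIV"
      "(\<lambda>q. H (T1 (T2 q))) summable_on UNIV"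
    using summable_on_reindex_bij_betw[OF b1, of H] summable_on_reindex_bij_betw[OF b2, of H]
      summable_on_reindex_bij_betw[OF b12, of H] HS by simp_all
  \<comment> \<open>The four sums are reindexings of one sum, hence the factor 4 in
    \<open>HX\<close>.\<close>
  have "infsum H UNIV + infsum H UNIV + (infsum H UNIV + infsum H UNIV)
    = (\<Sum>\<^sub>\<infinity>q. H q + H (T1 q) + (H (T2 q) + H (T1 (T2 q))))"
    unfolding infsum_add[OF summable_on_add[OF HS S(1)] summable_on_add[OF S(2,3)]]
      infsum_add[OF HS S(1)] infsum_add[OF S(2,3)] infsum_reindex_bij_betw[OF b1]
      infsum_reindex_bij_betw[OF b2] infsum_reindex_bij_betw[OF b12] ..
  then have HX: "4 * infsum H UNIV = - 2 * infsum X UNIV"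
    unfolding sym by (simp add: infsum_cmult_right' infsum_uminus)
  have XS: "(\<lambda>q. cmod (X q)) summable_on UNIV"
  proof -
    let ?N = "\<lambda>p. cmod (xterm t s \<phi> p)"
    note xs = xterm_summable[OF assms]
    \<comment> \<open>For fixed \<open>p = (- m, a)\<close> the sum over \<open>b\<close> is a fibre
      of a summable family, bounded by its total.\<close>
    have "(\<lambda>(p, b). ?N p * ?N (- fst p, b)) summable_on UNIV"
    proof (rule summable_on_times_bounded[OF xs])
      show "(\<lambda>b. ?N (- fst p, b)) summable_on UNIV" for p :: "int \<times> int"
        by (rule fibre_sums_abs_summable(2)[OF xs])
      show "(\<Sum>\<^sub>\<infinity>b. ?N (- fst p, b)) \<le> infsum ?N UNIV" for p :: "int \<times> int"
      proof -
        have "(\<Sum>\<^sub>\<infinity>b. ?N (- fst p, b)) = infsum ?N (range (Pair (- fst p)))"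
          by (subst infsum_reindex) (auto simp: o_def inj_on_def)
        also have "\<dots> \<le> infsum ?N UNIV"
          by (intro infsum_mono2 xs summable_on_subset_banach[OF xs]) auto
        finally show ?thesis .
      qed
    qed auto
    moreover have "bij (\<lambda>(m::int, a::int, b::int). ((- m, a), b))"
      by (rule bij_betw_byWitness[of _ "\<lambda>((m, a), b). (- m, a, b)"]) auto
    ultimately have "(\<lambda>q. case (case q of (m, a, b) \<Rightarrow> ((- m, a), b)) of (p, b) \<Rightarrow> ?N p * ?N (- fst p, b)) summable_on UNIV"
      by (subst summable_on_reindex_bij_betw)
    then show ?thesis by (simp add: X_def case_prod_unfold norm_mult)
  qed
  have "infsum X UNIV = (\<Sum>\<^sub>\<infinity>m. \<Sum>\<^sub>\<infinity>p. X (m, p))"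
    by (rule fibre_sums_abs_summable(3)[OF XS, symmetric])
  also have "\<dots> = (\<Sum>\<^sub>\<infinity>m. \<Sum>\<^sub>\<infinity>a. \<Sum>\<^sub>\<infinity>b. X (m, a, b))"
    by (subst fibre_sums_abs_summable(3)[OF fibre_sums_abs_summable(2)[OF XS]]) simp
  \<comment> \<open>For fixed \<open>m\<close> the sums over \<open>a\<close> and \<open>b\<close>
    factor into the coefficients of X at \<open>- m\<close> and \<open>m\<close>.\<close>
  also have "\<dots> = (\<Sum>\<^sub>\<infinity>m. cnj (Xop t s \<phi> \<phi> m) * Xop t s \<phi> \<phi> m)"
    by (simp add: X_def infsum_cmult_right' infsum_cmult_left' cnj_Xop[OF assms] flip: Xop_eq[OF assms])
  also have "\<dots> = of_real (sqnorm (Xop t s \<phi> \<phi>))"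
    unfolding sqnorm_eq_ip[OF l2_Xop[OF assms]] ip_def ..
  finally have "4 * ip \<phi> (X2op t s \<phi> \<phi> \<phi>) = - 2 * of_real (sqnorm (Xop t s \<phi> \<phi>))"
    using HX ipH by simp
  then show ?thesis by simp
qed

section \<open>Increments of the norm and constancy in time\<close>

text \<open>Along a solution the three summands on the right have orders 3\<eta>, \<eta> + 2\<eta>
  and 4\<eta> in the time step.\<close>

lemma sqnorm_increment:
  assumes u: "u \<in> L2_0" and w: "w \<in> L2_0" and "s \<le> t"
  defines "d \<equiv> w - u" and "r \<equiv> w - u - Xop t s u u"
    and "q \<equiv> w - u - Xop t s u u - X2op t s u u u"
  shows "\<bar>sqnorm w - sqnorm u\<bar> \<le> 2 * (sqrt (sqnorm u) * sqrt (sqnorm q))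
    + 2 * (sqrt (sqnorm d) * sqrt (sqnorm r)) + sqnorm r"
proof -
  let ?X = "Xop t s u u" and ?Y = "X2op t s u u u"
  have X: "l2 ?X" by (rule l2_Xop[OF u \<open>s \<le> t\<close>])
  have Y: "l2 ?Y" by (rule l2_X2op[OF u \<open>s \<le> t\<close>])
  have lu: "l2 u" by (rule L2_0_l2[OF u])
  have d: "l2 d" using l2_diff[OF L2_0_l2[OF w] lu] by (simp add: d_def fun_diff_def)
  have r: "l2 r" using l2_diff[OF d X] by (simp add: d_def r_def fun_diff_def)
  have q: "l2 q" using l2_diff[OF r Y] by (simp add: q_def r_def fun_diff_def)
  have "sqnorm w = sqnorm u + 2 * Re (ip u d) + sqnorm d"
    using sqnorm_add[OF lu d] by (simp add: d_def)
  moreover have "ip u d = ip u ?X + (ip u ?Y + ip u q)"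
  proof -
    have "d = (\<lambda>k. ?X k + (?Y k + q k))" by (simp add: q_def d_def fun_eq_iff)
    then show ?thesis
      using ip_add_right[OF lu X l2_add[OF Y q]] ip_add_right[OF lu Y q] by simp
  qed
  moreover have "ip u ?X = 0" by (rule ip_Xop_eq_0[OF u \<open>s \<le> t\<close>])
  moreover have "2 * Re (ip u ?Y) = - sqnorm ?X"
    using arg_cong[OF ip_X2op[OF u \<open>s \<le> t\<close>], of Re] by simp
  \<comment> \<open>This trades \<open>sqnorm ?X\<close> for \<open>sqnorm d\<close>, which cancels
    the quadratic term in the expansion of \<open>sqnorm w\<close>; that term alone is only
    controlled to order 2\<eta>.\<close>
  moreover have "sqnorm ?X = sqnorm d - 2 * Re (ip d r) + sqnorm r"
  proof -
    have "?X = (\<lambda>k. d k - r k)" by (simp add: d_def r_def fun_eq_iff)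
    then show ?thesis using sqnorm_diff[OF d r] by simp
  qed
  ultimately have "sqnorm w - sqnorm u = 2 * Re (ip u q) + 2 * Re (ip d r) - sqnorm r"
    by simp
  then show ?thesis
    using order_trans[OF abs_Re_le_cmod ip_Cauchy_Schwarz[OF lu q]]
      order_trans[OF abs_Re_le_cmod ip_Cauchy_Schwarz[OF d r]] sqnorm_nonneg[of r] by linarith
qed

text \<open>Difference quotients are bounded by a positive power of the distance, so the derivative
  vanishes.\<close>

lemma constant_if_superlinear_Hoelder:
  fixes E :: "real \<Rightarrow> real"
  assumes "\<beta> > 1"
    and E: "\<And>s t. 0 \<le> s \<Longrightarrow> s \<le> t \<Longrightarrow> t \<le> T \<Longrightarrow> \<bar>E t - E s\<bar> \<le> K * \<bar>t - s\<bar> powr \<beta>"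
    and "t \<in> {0..T}"
  shows "E t = E 0"
proof -
  have E2: "\<bar>E y - E x\<bar> \<le> K * \<bar>y - x\<bar> powr \<beta>" if "x \<in> {0..T}" "y \<in> {0..T}" for x y
    using that E[of x y] E[of y x] by (cases "x \<le> y") (auto simp: abs_minus_commute)
  have "(E has_field_derivative 0) (at x within {0..T})" if x: "x \<in> {0..T}" for x
    unfolding has_field_derivative_iff
  proof (rule Lim_null_comparison)
    show "\<forall>\<^sub>F y in at x within {0..T}. norm ((E y - E x) / (y - x)) \<le> K * \<bar>y - x\<bar> powr (\<beta> - 1)"
      unfolding eventually_at_filter
    proof (intro always_eventually allI impI)
      fix y assume "y \<noteq> x" "y \<in> {0..T}"
      then show "norm ((E y - E x) / (y - x)) \<le> K * \<bar>y - x\<bar> powr (\<beta> - 1)"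
        using E2[OF x, of y] by (simp add: powr_diff divide_right_mono)
    qed
    \<comment> \<open>Continuity of \<open>powr\<close> at base 0 uses that the exponent
      \<open>\<beta> - 1\<close> is positive.\<close>
    have "((\<lambda>y. K * \<bar>y - x\<bar> powr (\<beta> - 1)) \<longlongrightarrow> K * \<bar>x - x\<bar> powr (\<beta> - 1)) (at x within {0..T})"
      using \<open>\<beta> > 1\<close> by (intro tendsto_intros tendsto_powr2) auto
    then show "((\<lambda>y. K * \<bar>y - x\<bar> powr (\<beta> - 1)) \<longlongrightarrow> 0) (at x within {0..T})" by simp
  qed
  then obtain c where "\<And>x. x \<in> {0..T} \<Longrightarrow> E x = c"
    using has_field_derivative_zero_constant[of "{0..T}" E] by blast
  then show ?thesis using \<open>t \<in> {0..T}\<close> by auto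
qed

text \<open>The Hoelder constants come without a sign; nonnegative ones allow the inequalities to be
  multiplied.\<close>

lemma Hoelder_bound_pos:
  fixes x C :: real
  assumes "x \<le> C * p" "0 \<le> p" shows "x \<le> \<bar>C\<bar> * p"
  using assms mult_right_mono[OF abs_ge_self[of C], of p] by linarith

theorem theorem3:
  fixes \<eta> T :: real and v :: "real \<Rightarrow> int \<Rightarrow> complex"
  assumes "\<eta> > 1/3"
    and "KdV_Lambda_solution \<eta> T v"
  shows "\<forall>t\<in>{0..T}. (L2norm (v t))\<^sup>2 = (L2norm (v 0))\<^sup>2"
proof
  fix \<tau> assume \<tau>: "\<tau> \<in> {0..T}"
  let ?n = "\<lambda>f::fcoef. sqrt (sqnorm f)"
  let ?r = "\<lambda>s t. v t - v s - Xop t s (v s) (v s)"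
  let ?q = "\<lambda>s t. v t - v s - Xop t s (v s) (v s) - X2op t s (v s) (v s) (v s)"
  have v: "\<And>t. t \<in> {0..T} \<Longrightarrow> v t \<in> L2_0"
    using assms(2) by (auto simp: KdV_Lambda_solution_def)
  obtain C1 where "\<And>s t. 0 \<le> s \<Longrightarrow> s \<le> t \<Longrightarrow> t \<le> T \<Longrightarrow> L2norm (v t - v s) \<le> C1 * \<bar>t - s\<bar> powr \<eta>"
    using assms(2) unfolding KdV_Lambda_solution_def by blast
  then have C1: "?n (v t - v s) \<le> \<bar>C1\<bar> * \<bar>t - s\<bar> powr \<eta>" if "0 \<le> s" "s \<le> t" "t \<le> T" for s t
    using that by (intro Hoelder_bound_pos order_trans[OF sqrt_sqnorm_le_L2norm]) auto
  obtain C2 where "\<And>s t. 0 \<le> s \<Longrightarrow> s \<le> t \<Longrightarrow> t \<le> T \<Longrightarrow> L2norm (?r s t) \<le> C2 * \<bar>t - s\<bar> powr (2 * \<eta>)"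
    using assms(2) unfolding KdV_Lambda_solution_def by blast
  then have C2: "?n (?r s t) \<le> \<bar>C2\<bar> * \<bar>t - s\<bar> powr (2 * \<eta>)" if "0 \<le> s" "s \<le> t" "t \<le> T" for s t
    using that by (intro Hoelder_bound_pos order_trans[OF sqrt_sqnorm_le_L2norm]) auto
  obtain C3 where "\<And>s t. 0 \<le> s \<Longrightarrow> s \<le> t \<Longrightarrow> t \<le> T \<Longrightarrow> L2norm (?q s t) \<le> C3 * \<bar>t - s\<bar> powr (3 * \<eta>)"
    using assms(2) unfolding KdV_Lambda_solution_def by blast
  then have C3: "?n (?q s t) \<le> \<bar>C3\<bar> * \<bar>t - s\<bar> powr (3 * \<eta>)" if "0 \<le> s" "s \<le> t" "t \<le> T" for s t
    using that by (intro Hoelder_bound_pos order_trans[OF sqrt_sqnorm_le_L2norm]) auto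
  have pT: "\<bar>t - s\<bar> powr \<eta> \<le> T powr \<eta>" if "0 \<le> s" "s \<le> t" "t \<le> T" for s t
    using that assms(1) by (intro powr_mono2) auto
  \<comment> \<open>\<open>B\<close> bounds all norms on the time interval, through
    \<open>v s = v 0 + (v s - v 0)\<close> and the Hoelder bound from time 0.\<close>
  define B where "B = sqrt (2 * sqnorm (v 0) + 2 * (\<bar>C1\<bar> * T powr \<eta>)\<^sup>2)"
  have B: "?n (v s) \<le> B" if s: "0 \<le> s" "s \<le> T" for s
  proof -
    have 0: "v 0 \<in> L2_0" "v s \<in> L2_0" using v s by auto
    have d: "l2 (v s - v 0)" using l2_diff[OF L2_0_l2[OF 0(2)] L2_0_l2[OF 0(1)]] by (simp add: fun_diff_def)
    have "?n (v s - v 0) \<le> \<bar>C1\<bar> * T powr \<eta>"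
      using order_trans[OF C1[of 0 s] mult_left_mono[OF pT[of 0 s] abs_ge_zero[of C1]]] s by simp
    then have "sqnorm (v s - v 0) \<le> (\<bar>C1\<bar> * T powr \<eta>)\<^sup>2"
      using sqrt_le_D by blast
    moreover have "sqnorm (v s) \<le> 2 * sqnorm (v 0) + 2 * sqnorm (v s - v 0)"
      using sqnorm_add_le[OF L2_0_l2[OF 0(1)] d] by simp
    ultimately show ?thesis unfolding B_def by (intro real_sqrt_le_mono) simp
  qed
  \<comment> \<open>The coefficients of the three terms of \<open>sqnorm_increment\<close>; in the
    last one \<open>T powr \<eta>\<close> absorbs the excess of order 4\<eta> over 3\<eta>.\<close>
  let ?K = "2 * (B * \<bar>C3\<bar>) + 2 * (\<bar>C1\<bar> * \<bar>C2\<bar>) + \<bar>C2\<bar> * \<bar>C2\<bar> * T powr \<eta>"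
  have "\<bar>sqnorm (v t) - sqnorm (v s)\<bar> \<le> ?K * \<bar>t - s\<bar> powr (3 * \<eta>)" if st: "0 \<le> s" "s \<le> t" "t \<le> T" for s t
  proof -
    let ?p = "\<lambda>c. \<bar>t - s\<bar> powr (c * \<eta>)"
    have p: "\<bar>t - s\<bar> powr \<eta> * ?p 2 = ?p 3" "?p 2 * ?p 2 = \<bar>t - s\<bar> powr \<eta> * ?p 3"
      by (simp_all flip: powr_add add: algebra_simps)
    have nn: "0 \<le> ?n f" for f by (simp add: sqnorm_nonneg)
    have "?n (v s) * ?n (?q s t) \<le> B * (\<bar>C3\<bar> * ?p 3)"
      by (rule mult_mono[OF B C3 order_trans[OF nn B] nn]) (use st in auto)
    moreover have "?n (v t - v s) * ?n (?r s t) \<le> (\<bar>C1\<bar> * \<bar>t - s\<bar> powr \<eta>) * (\<bar>C2\<bar> * ?p 2)"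
      by (rule mult_mono[OF C1 C2 _ nn]) (use st in auto)
    moreover have "sqnorm (?r s t) \<le> \<bar>C2\<bar> * \<bar>C2\<bar> * (T powr \<eta> * ?p 3)"
    proof -
      have "sqnorm (?r s t) = ?n (?r s t) * ?n (?r s t)" by (simp add: sqnorm_nonneg)
      also have "\<dots> \<le> (\<bar>C2\<bar> * ?p 2) * (\<bar>C2\<bar> * ?p 2)"
        by (rule mult_mono[OF C2 C2 _ nn]) (use st in auto)
      also have "\<dots> = \<bar>C2\<bar> * \<bar>C2\<bar> * (?p 2 * ?p 2)" by (simp only: mult_ac)
      also have "\<dots> \<le> \<bar>C2\<bar> * \<bar>C2\<bar> * (T powr \<eta> * ?p 3)"
        unfolding p(2) using pT[OF st] by (intro mult_left_mono mult_right_mono) auto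
      finally show ?thesis .
    qed
    moreover have "\<bar>sqnorm (v t) - sqnorm (v s)\<bar> \<le> 2 * (?n (v s) * ?n (?q s t))
        + 2 * (?n (v t - v s) * ?n (?r s t)) + sqnorm (?r s t)"
      by (rule sqnorm_increment) (use v st in auto)
    moreover have "(\<bar>C1\<bar> * \<bar>t - s\<bar> powr \<eta>) * (\<bar>C2\<bar> * ?p 2) = \<bar>C1\<bar> * \<bar>C2\<bar> * ?p 3"
      unfolding p(1)[symmetric] by (simp only: mult_ac)
    moreover have "?K * ?p 3 = 2 * (B * (\<bar>C3\<bar> * ?p 3)) + 2 * (\<bar>C1\<bar> * \<bar>C2\<bar> * ?p 3)
        + \<bar>C2\<bar> * \<bar>C2\<bar> * (T powr \<eta> * ?p 3)"
      by (simp only: distrib_right mult.assoc)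
    ultimately show ?thesis by linarith
  qed
  then have "sqnorm (v \<tau>) = sqnorm (v 0)"
    using assms(1) \<tau> by (intro constant_if_superlinear_Hoelder[where \<beta> = "3 * \<eta>" and E = "\<lambda>t. sqnorm (v t)"]) auto
  then show "(L2norm (v \<tau>))\<^sup>2 = (L2norm (v 0))\<^sup>2" by (simp add: L2norm_power2)
qed


end
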